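(* Let $A$, $A_1$, $B$, $B_1$, $B_2$, $C_1$, $C_1-A_1$ and $\mathbb{Y}$ be positive stable matrices in $\mathbb{C}^{r\times r}$ such that $A$, $A_1$, $B$, $C_1$, $\mathbb{Y}$ commute with each other, and let $z,w\in\mathbb{C}$ with $|z|<1$, $|w|<1$. (i) If $B-I$ is positive stable (so that the function with parameter $B-I$ is defined), then $$\begin{aligned}(B-(A+I))\,&F_1^{(A,B)}(A_1,B_1,B_2;C_1;z,w;\mathbb{Y})\\&=(B-I)\,F_1^{(A,B-I)}(A_1,B_1,B_2;C_1;z,w;\mathbb{Y})-A\,F_1^{(A+I,B)}(A_1,B_1,B_2;C_1;z,w;\mathbb{Y}).\end{aligned}$$ (ii) If $A-I$, $A_1-I$ and $C_1-A_1-I$ are positive stable (so that the functions with the shifted parameters are defined), then $$\begin{aligned}&B\,F_1^{(A,B)}(A_1,B_1,B_2;C_1;z,w;\mathbb{Y})-B\,F_1^{(A-I,B)}(A_1,B_1,B_2;C_1;z,w;\mathbb{Y})\\&\quad+\mathbb{Y}\,[\mathfrak{B}(A_1,C_1-A_1)]^{-1}\,\mathfrak{B}(A_1-I,C_1-A_1-I)\,F_1^{(A,B+I)}(A_1-I,B_1,B_2;C_1-2I;z,w;\mathbb{Y})=0.\end{aligned}$$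
   Context: A matrix in $\mathbb{C}^{r\times r}$ is positive stable if all its eigenvalues have positive real part; $I$ is the identity matrix. For $t>0$ and a square matrix $M$, $t^M=\exp(M\ln t)$. The Pochhammer symbol is $(M)_0=I$, $(M)_n=M(M+I)\cdots(M+(n-1)I)$ for $n\ge1$. For positive stable $B$ and a square matrix $W$, ${}_1F_1(A;B;W)=\sum_{n\ge0}(A)_n\,[(B)_n]^{-1}\,\frac{W^n}{n!}$. For commuting positive stable $P,Q$, the beta matrix function is $\mathfrak{B}(P,Q)=\Gamma(P)\Gamma(Q)\Gamma^{-1}(P+Q)=\int_0^1t^{P-I}(1-t)^{Q-I}dt$, where $\Gamma(P)=\int_0^\infty e^{-t}t^{P-I}dt$. For positive stable $A,B,P,Q,\mathbb{Y}$, $$\mathfrak{B}_{\mathbb{Y}}^{(A,B)}(P,Q)=\int_0^1 {}_1F_1\!\left(A;B;-\frac{\mathbb{Y}}{t(1-t)}\right)t^{P-I}(1-t)^{Q-I}\,dt .$$ For positive stable $A,A_1,B,B_1,B_2,C_1,C_1-A_1,\mathbb{Y}$ the new extended Appell matrix function is $$F_1^{(A,B)}(A_1,B_1,B_2;C_1;z,w;\mathbb{Y})=\sum_{m,n\ge0}\mathfrak{B}_{\mathbb{Y}}^{(A,B)}(A_1+(m+n)I,C_1-A_1)\,[\mathfrak{B}(A_1,C_1-A_1)]^{-1}(B_1)_m(B_2)_n\frac{z^mw^n}{m!\,n!}.$$ *)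

theory Defs
  imports "HOL-Analysis.Analysis"
begin

text \<open>
  Matrices are \<open>complex^'r^'r\<close>. On this type \<open>(*)\<close>, \<open>(^)\<close> and \<open>1\<close> are the componentwise
  operations, so the product is always \<open>(**)\<close> and the identity is \<open>mat 1\<close>; consequently
  \<open>mat c\<close> is \<open>c I\<close> and \<open>mat c ** M\<close> is the multiple of \<open>M\<close> by the complex scalar \<open>c\<close>.
\<close>

definition matrix_eigenvalue :: "complex^'r^'r \<Rightarrow> complex \<Rightarrow> bool" where
  "matrix_eigenvalue M l \<longleftrightarrow> (\<exists>v. v \<noteq> 0 \<and> M *v v = l *s v)"

definition positive_stable :: "complex^'r^'r \<Rightarrow> bool" where
  "positive_stable M \<longleftrightarrow> (\<forall>l. matrix_eigenvalue M l \<longrightarrow> 0 < Re l)"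

primrec matrix_power :: "complex^'r^'r \<Rightarrow> nat \<Rightarrow> complex^'r^'r" where
  "matrix_power M 0 = mat 1"
| "matrix_power M (Suc n) = M ** matrix_power M n"

definition matrix_exp :: "complex^'r^'r \<Rightarrow> complex^'r^'r" where
  "matrix_exp M = (\<Sum>n. (1 / fact n) *\<^sub>R matrix_power M n)"

definition real_powr_matrix :: "real \<Rightarrow> complex^'r^'r \<Rightarrow> complex^'r^'r" where
  "real_powr_matrix t M = matrix_exp (ln t *\<^sub>R M)"

primrec matrix_pochhammer :: "complex^'r^'r \<Rightarrow> nat \<Rightarrow> complex^'r^'r" where
  "matrix_pochhammer M 0 = mat 1"
| "matrix_pochhammer M (Suc n) = matrix_pochhammer M n ** (M + mat (of_nat n))"

definition matrix_1F1 :: "complex^'r^'r \<Rightarrow> complex^'r^'r \<Rightarrow> complex^'r^'r \<Rightarrow> complex^'r^'r" where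
  "matrix_1F1 A B W =
     (\<Sum>n. matrix_pochhammer A n ** matrix_inv (matrix_pochhammer B n)
             ** ((1 / fact n) *\<^sub>R matrix_power W n))"

definition matrix_Gamma :: "complex^'r^'r \<Rightarrow> complex^'r^'r" where
  "matrix_Gamma P = (LBINT t:{0<..}. exp (- t) *\<^sub>R real_powr_matrix t (P - mat 1))"

definition matrix_Beta :: "complex^'r^'r \<Rightarrow> complex^'r^'r \<Rightarrow> complex^'r^'r" where
  "matrix_Beta P Q = matrix_Gamma P ** matrix_Gamma Q ** matrix_inv (matrix_Gamma (P + Q))"

definition extended_Beta ::
  "complex^'r^'r \<Rightarrow> complex^'r^'r \<Rightarrow> complex^'r^'r \<Rightarrow> complex^'r^'r \<Rightarrow> complex^'r^'r \<Rightarrow> complex^'r^'r"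
where
  "extended_Beta A B Y P Q =
     (LBINT t:{0<..<1}. matrix_1F1 A B ((- 1 / (t * (1 - t))) *\<^sub>R Y)
         ** real_powr_matrix t (P - mat 1) ** real_powr_matrix (1 - t) (Q - mat 1))"

text \<open>
  \<open>extended_Appell_F1 A B A1 B1 B2 C1 z w Y\<close> is
  $F_1^{(A,B)}(A_1,B_1,B_2;C_1;z,w;Y)$. The double series is the unordered sum over all
  pairs of indices, which in this finite-dimensional space means absolute convergence.
\<close>

definition extended_Appell_F1 ::
  "complex^'r^'r \<Rightarrow> complex^'r^'r \<Rightarrow> complex^'r^'r \<Rightarrow> complex^'r^'r \<Rightarrow> complex^'r^'r \<Rightarrow> complex^'r^'r
    \<Rightarrow> complex \<Rightarrow> complex \<Rightarrow> complex^'r^'r \<Rightarrow> complex^'r^'r"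
where
  "extended_Appell_F1 A B A1 B1 B2 C1 z w Y =
     (\<Sum>\<^sub>\<infinity>(m, n)\<in>UNIV.
        mat (z ^ m * w ^ n / (fact m * fact n)) **
        (extended_Beta A B Y (A1 + mat (of_nat (m + n))) (C1 - A1)
          ** matrix_inv (matrix_Beta A1 (C1 - A1))
          ** matrix_pochhammer B1 m ** matrix_pochhammer B2 n))"

end

(*
Both identities are contiguous relations of 1F1, integrated against the beta kernel and summed.
What needs proof is that every integral and every double series converges absolutely, and that
the beta matrices are invertible.

Convergence rests on the boundedness of x |-> 1F1(A; B; -xY) on the half line x >= 0. Nothing is
assumed about B - A, so Kummer's integral is not available. Instead, with theta = x d/dx,
f = 1F1(A; B; -xY) and g = (theta + A) f, Kummer's equation reads
  x f' = g - A f,    x g' = (1 + A - B) (g - A f) - x Y g.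
Since A and Y are positive stable, variation of constants bounds f by the supremum of |g|, and g by
O(1/x0) times the suprema of |f| and |g| on [x0, x]; for large x0 these bounds close up.

Spectral arguments (decay of exp(-xY), invertibility of Gamma(P)) use induction along generalized
eigenvectors, so that no normal form of matrices is needed.
*)
theory Submission
  imports Defs "HOL-Computational_Algebra.Fundamental_Theorem_Algebra"
begin

subsection \<open>Matrix algebra\<close>

text \<open>The unknown g = (theta + A) f separates the two modes at infinity: without coupling, f
  behaves like x^(-A) and g like exp(-xY). Both decay, so each equation can be solved forward with
  its own integrating factor, and the remaining terms of g' carry a factor 1/x. Boundedness of 1F1
  is enough at both ends of (0,1), where -Y/(t(1-t)) goes to infinity: the integrand is dominated by
  a scalar beta integrand, uniformly in m + n because t^(m+n) \<le> 1. The double series is then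
  dominated by a product of two single series. B1 and B2 are not assumed to commute with anything,
  so every multiplier acts from the left and moves only through scalars and matrices built from A,
  A1, B, C1, Y. In (ii) the relation of 1F1 brings in the factor -Y/(t(1-t)), which lowers both
  exponents of the kernel by I; this is the origin of A1 - I and C1 - 2I. The quotient of beta
  matrices exchanges the normalizations of the two functions.\<close>

lemma norm_matrix_mult_le:
  fixes A B :: "complex^'n^'n"
  shows "norm (A ** B) \<le> norm A * norm B"
proof -
  \<comment> \<open>\<open>norm\<close> is the Frobenius norm on this type. \<open>b j\<close> is
    the norm of column j of B, and Cauchy-Schwarz for a row of A and a column of B gives the
    constant 1.\<close>
  define b where "b j = L2_set (\<lambda>k. norm (B $ k $ j)) UNIV" for j
  have entry: "norm ((A ** B) $ i $ j) \<le> norm (A $ i) * b j" for i j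
  proof -
    have "norm ((A ** B) $ i $ j) \<le> (\<Sum>k\<in>UNIV. \<bar>norm (A $ i $ k)\<bar> * \<bar>norm (B $ k $ j)\<bar>)"
      unfolding matrix_matrix_mult_def
      by (simp add: norm_mult[symmetric] del: norm_mult) (rule norm_sum)
    also have "\<dots> \<le> norm (A $ i) * b j"
      unfolding norm_vec_def b_def by (rule L2_set_mult_ineq)
    finally show ?thesis .
  qed
  have row: "norm ((A ** B) $ i) \<le> norm (A $ i) * L2_set b UNIV" for i
  proof -
    have "norm ((A ** B) $ i) \<le> L2_set (\<lambda>j. norm (A $ i) * b j) UNIV"
      unfolding norm_vec_def[of "(A ** B) $ i"] by (rule L2_set_mono) (use entry in auto)
    then show ?thesis by (simp add: L2_set_right_distrib)
  qed
  have "norm (A ** B) \<le> L2_set (\<lambda>i. norm (A $ i) * L2_set b UNIV) UNIV"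
    unfolding norm_vec_def[of "A ** B"] by (rule L2_set_mono) (use row in auto)
  also have "\<dots> = norm A * L2_set b UNIV"
    by (simp add: norm_vec_def L2_set_left_distrib)
  also have "L2_set b UNIV = norm B"
    unfolding b_def L2_set_def norm_vec_def
    by (simp add: sum_nonneg) (subst sum.swap, rule refl)
  finally show ?thesis .
qed

text \<open>Multiplication on the type is componentwise, so \<open>**\<close> is registered as a
  bounded bilinear map. The rules for sums, series, integrals and derivatives of matrix products
  come from here, and those for \<open>*v\<close> from the next interpretation.\<close>

interpretation mm: bounded_bilinear "(**) :: complex^'n^'n \<Rightarrow> complex^'n^'n \<Rightarrow> complex^'n^'n"
proof
  fix a a' b b' :: "complex^'n^'n" and r :: real
  show "(a + a') ** b = a ** b + a' ** b" 
    by (simp add: vec_eq_iff matrix_matrix_mult_def algebra_simps sum.distrib)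
  show "a ** (b + b') = a ** b + a ** b'" by (rule matrix_add_ldistrib)
  show "r *\<^sub>R a ** b = r *\<^sub>R (a ** b)"
    by (simp add: vec_eq_iff matrix_matrix_mult_def scaleR_sum_right)
  show "a ** r *\<^sub>R b = r *\<^sub>R (a ** b)"
    by (simp add: vec_eq_iff matrix_matrix_mult_def scaleR_sum_right)
  show "\<exists>K. \<forall>(a::complex^'n^'n) (b::complex^'n^'n). norm (a ** b) \<le> norm a * norm b * K"
    by (intro exI[of _ 1]) (simp add: norm_matrix_mult_le)
qed

interpretation mv: bounded_bilinear "(*v) :: complex^'n^'n \<Rightarrow> complex^'n \<Rightarrow> complex^'n"
proof -
  have "(r *\<^sub>R M) *v v = r *\<^sub>R (M *v v)" for r and M :: "complex^'n^'n" and v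
    by (simp add: vec_eq_iff matrix_vector_mult_def scaleR_sum_right)
  then have "bilinear ((*v) :: complex^'n^'n \<Rightarrow> complex^'n \<Rightarrow> complex^'n)"
    unfolding bilinear_def
    by (auto intro!: linearI simp: matrix_vector_mult_add_rdistrib matrix_vector_right_distrib
        matrix_vector_mult_scaleR)
  then show "bounded_bilinear ((*v) :: complex^'n^'n \<Rightarrow> complex^'n \<Rightarrow> complex^'n)"
    by (simp add: bilinear_conv_bounded_bilinear)
qed

lemma mat_mult_nth [simp]: "(mat c ** (M :: complex^'n^'n)) $ i $ j = c * M $ i $ j"
  by (simp add: matrix_matrix_mult_def mat_def)
    (auto simp only: if_distrib if_distribR sum.delta'[OF finite] mult_zero_left if_True UNIV_I)

lemma mult_mat_nth [simp]: "((M :: complex^'n^'n) ** mat c) $ i $ j = c * M $ i $ j"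
proof -
  have "(\<Sum>k\<in>UNIV. M $ i $ k * (if k = j then c else 0))
      = (\<Sum>k\<in>UNIV. if k = j then c * M $ i $ k else 0)"
    by (intro sum.cong) auto
  then show ?thesis by (simp add: matrix_matrix_mult_def mat_def)
qed

lemma mat_mult_commute: "mat c ** (M :: complex^'n^'n) = M ** mat c"
  by (simp add: vec_eq_iff)

lemma mat_mult_mat: "mat a ** mat b = (mat (a * b) :: complex^'n^'n)"
  by (simp add: vec_eq_iff) (simp add: mat_def)

lemma mat_add: "mat a + mat b = (mat (a + b) :: complex^'n^'n)"
  by (simp add: vec_eq_iff mat_def)

lemma mat_of_real: "mat (of_real r) = r *\<^sub>R (mat 1 :: complex^'n^'n)"
  by (simp add: vec_eq_iff mat_def complex_eq_iff)

lemma mat_of_real_mult: "mat (of_real r) ** (M :: complex^'n^'n) = r *\<^sub>R M"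
  by (simp add: mat_of_real mm.scaleR_left)

lemma mat_vector_mult: "mat c *v v = c *s (v :: complex^'n)"
  by (simp add: vec_eq_iff matrix_vector_mult_def mat_def)
    (auto simp only: if_distrib if_distribR sum.delta'[OF finite] mult_zero_left if_True UNIV_I)

lemma norm_mat_mult: "norm (mat c ** (M :: complex^'n^'n)) = norm c * norm M"
  by (simp add: norm_vec_def norm_mult L2_set_right_distrib)

lemma invertible_iff_ker:
  "invertible (M :: complex^'n^'n) \<longleftrightarrow> (\<forall>v. M *v v = 0 \<longrightarrow> v = 0)"
  by (metis invertible_left_inverse matrix_left_invertible_ker)

lemma
  fixes M :: "complex^'n^'n"
  assumes "invertible M"
  shows matrix_mult_inv: "M ** matrix_inv M = mat 1" and matrix_inv_mult: "matrix_inv M ** M = mat 1"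
  using assms someI_ex[of "\<lambda>N. M ** N = mat 1 \<and> N ** M = mat 1"]
  by (auto simp: invertible_def matrix_inv_def)

lemma matrix_inv_commute:
  fixes M X :: "complex^'n^'n"
  assumes "invertible M" "X ** M = M ** X"
  shows "X ** matrix_inv M = matrix_inv M ** X"
proof -
  have "X ** matrix_inv M = matrix_inv M ** (M ** X) ** matrix_inv M"
    using assms by (simp add: matrix_mul_assoc matrix_inv_mult)
  also have "\<dots> = matrix_inv M ** X ** (M ** matrix_inv M)"
    unfolding assms(2)[symmetric] by (simp add: matrix_mul_assoc)
  finally show ?thesis using assms by (simp add: matrix_mult_inv)
qed

subsection \<open>Induction along generalized eigenvectors\<close>

text \<open>Horner's scheme for p(M) v. Only the action on one vector at a time is used.\<close>

definition poly_act :: "complex^'n^'n \<Rightarrow> complex poly \<Rightarrow> complex^'n \<Rightarrow> complex^'n" where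
  "poly_act M p v = fold_coeffs (\<lambda>a u. a *s v + M *v u) p 0"

lemma poly_act_0 [simp]: "poly_act M 0 v = 0"
  by (simp add: poly_act_def)

lemma poly_act_pCons [simp]: "poly_act M (pCons a p) v = a *s v + M *v poly_act M p v"
  by (cases "p = 0 \<and> a = 0") (auto simp: poly_act_def)

lemma poly_act_add: "poly_act M (p + q) v = poly_act M p v + poly_act M q v"
  by (induction p q rule: poly_induct2)
    (simp_all add: matrix_vector_right_distrib vector_sadd_rdistrib)

lemma poly_act_monom: "poly_act M (monom c n) v = c *s (matrix_power M n *v v)"
  by (induction n)
    (simp_all add: monom_0 monom_Suc matrix_vector_mul_assoc[symmetric] vector_scalar_commute)

lemma poly_act_sum: "poly_act M (\<Sum>i\<in>S. f i) v = (\<Sum>i\<in>S. poly_act M (f i) v)"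
  by (induction S rule: infinite_finite_induct) (simp_all add: poly_act_add)

lemma poly_act_mult: "poly_act M (p * q) v = poly_act M p (poly_act M q v)"
proof (induction p)
  case (pCons a p)
  have "poly_act M (smult a q) v = a *s poly_act M q v"
    by (induction q) (simp_all add: vector_add_ldistrib vector_smult_assoc vector_scalar_commute)
  with pCons show ?case by (simp add: poly_act_add)
qed simp

text \<open>A dimension count: v, M v, ..., M^n v are n + 1 vectors in a space of dimension
  n.\<close>

lemma annihilating_poly_exists:
  fixes M :: "complex^'n^'n"
  obtains p where "p \<noteq> 0" "poly_act M p v = 0"
proof -
  define f where "f i = matrix_power M i *v v" for i
  define N where "N = CARD('n)"
  show ?thesis
  \<comment> \<open>Linear dependence is a property of sets. A repetition among the vectors
    disappears in the set, so it is treated apart, with a difference of two monomials.\<close>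
  proof (cases "inj_on f {..N}")
    case False
    then obtain i j where ij: "i \<noteq> j" "f i = f j" by (auto simp: inj_on_def)
    define p where "p = monom (1::complex) i + monom (-1) j"
    have "coeff p i = 1" using ij by (simp add: p_def)
    then have "p \<noteq> 0" by auto
    moreover have "poly_act M p v = 0"
      using ij by (simp add: p_def poly_act_add poly_act_monom f_def)
    ultimately show ?thesis using that by blast
  next
    case True
    then have "card (f ` {..N}) = Suc N" by (simp add: card_image)
    then have "vec.dependent (f ` {..N})"
      using vec.independent_card_le_dim[of "f ` {..N}" UNIV]
      by (auto simp: N_def card_cart_basis)
    then obtain u where u: "\<exists>x\<in>f ` {..N}. u x \<noteq> 0" "(\<Sum>x\<in>f ` {..N}. u x *s x) = 0"
      using vec.dependent_finite[of "f ` {..N}"] by auto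
    then obtain i0 where i0: "i0 \<le> N" "u (f i0) \<noteq> 0" by auto
    define p where "p = (\<Sum>i\<le>N. monom (u (f i)) i)"
    have "coeff p i0 = u (f i0)" using i0 by (simp add: p_def coeff_sum)
    then have "p \<noteq> 0" using i0 by auto
    moreover have "poly_act M p v = (\<Sum>i\<le>N. u (f i) *s f i)"
      by (simp add: p_def poly_act_sum poly_act_monom f_def)
    then have "poly_act M p v = 0"
      using u(2) by (simp add: sum.reindex[OF True])
    ultimately show ?thesis using that by blast
  qed
qed

text \<open>An annihilating polynomial of v splits into linear factors over the complex numbers, and
  applying them one after the other leads from v to 0. Read backwards this is an induction from (M -
  l) v to v; factors whose root l is not an eigenvalue are cancelled.\<close>

lemma eigen_induct [case_names zero step]:
  fixes M :: "complex^'n^'n"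
  assumes zero: "P 0"
    and step: "\<And>v l. matrix_eigenvalue M l \<Longrightarrow> P (M *v v - l *s v) \<Longrightarrow> P v"
  shows "P v"
proof -
  obtain p where "p \<noteq> 0" "poly_act M p v = 0" by (rule annihilating_poly_exists)
  then show ?thesis
  proof (induction "degree p" arbitrary: p v)
    case 0
    then obtain a where "p = [:a:]" by (metis degree_eq_zeroE)
    with 0 zero show ?case by auto
  next
    case (Suc n)
    from Suc.hyps(2) obtain l where "poly p l = 0"
      using fundamental_theorem_of_algebra[of p] by (metis constant_degree nat.distinct(1))
    then obtain q where q: "p = q * [:-l, 1:]" by (metis dvdE mult.commute poly_eq_0_iff_dvd)
    have q0: "q \<noteq> 0" using q Suc.prems by auto
    then have deg: "n = degree q" using q Suc.hyps(2) by (simp add: degree_mult_eq del: mult_pCons_right)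
    have lin: "poly_act M [:-l, 1:] u = M *v u - l *s u" for u by simp
    show ?case
    proof (cases "matrix_eigenvalue M l")
      case True
      have "poly_act M q (M *v v - l *s v) = 0"
        using Suc.prems(2) unfolding q poly_act_mult lin .
      then have "P (M *v v - l *s v)" using Suc.hyps(1)[OF deg q0] by blast
      then show ?thesis using step True by blast
    next
      case False
      \<comment> \<open>If l is no eigenvalue, M - l is injective. With the linear factor moved to
        the front it can be cancelled, so q alone annihilates v.\<close>
      have "p = [:-l, 1:] * q" by (simp add: q mult.commute)
      then have "M *v poly_act M q v - l *s poly_act M q v = 0"
        using Suc.prems(2) by (metis lin poly_act_mult)
      then have "poly_act M q v = 0" using False unfolding matrix_eigenvalue_def by auto
      then show ?thesis using Suc.hyps(1)[OF deg q0] by blast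
    qed
  qed
qed

section \<open>Positive stable matrices: invertibility, shifts, commuting sums\<close>

lemma positive_stable_invertible:
  fixes M :: "complex^'n^'n"
  assumes "positive_stable M"
  shows "invertible M"
  unfolding invertible_iff_ker
proof (intro allI impI)
  fix v assume "M *v v = 0"
  then have "M *v v = 0 *s v" by simp
  then show "v = 0"
    using assms by (metis less_irrefl matrix_eigenvalue_def positive_stable_def zero_complex.simps(1))
qed

lemma eigenvalue_add_mat:
  "matrix_eigenvalue (M + mat c) l \<longleftrightarrow> matrix_eigenvalue (M :: complex^'n^'n) (l - c)"
  unfolding matrix_eigenvalue_def
  by (simp add: matrix_vector_mult_add_rdistrib mat_vector_mult vec_eq_iff left_diff_distrib
      eq_diff_eq)

lemma positive_stable_add_mat:
  fixes M :: "complex^'n^'n"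
  assumes "positive_stable M" "0 \<le> Re c"
  shows "positive_stable (M + mat c)"
  using assms unfolding positive_stable_def eigenvalue_add_mat by fastforce

text \<open>M preserves the eigenspace of M + N for l. Induction along M inside this space reduces
  to a common eigenvector; there N has the eigenvalue l - m, whose real part is nonpositive if Re l
  is.\<close>

lemma positive_stable_add:
  fixes M N :: "complex^'n^'n"
  assumes M: "positive_stable M" and N: "positive_stable N" and MN: "M ** N = N ** M"
  shows "positive_stable (M + N)"
  unfolding positive_stable_def
proof (intro allI impI, rule ccontr)
  fix l assume l: "matrix_eigenvalue (M + N) l" and neg: "\<not> 0 < Re l"
  have "(M + N) *v v = l *s v \<longrightarrow> v = 0" for v
  proof (induction v rule: eigen_induct[of _ M])
    case (step v m)
    show ?case
    proof
      assume v: "(M + N) *v v = l *s v"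
      have "(M + N) *v (M *v v) = M *v ((M + N) *v v)"
        by (simp add: matrix_vector_mul_assoc mm.add_left mm.add_right MN)
      then have "(M + N) *v (M *v v - m *s v) = l *s (M *v v - m *s v)"
        unfolding v by (simp add: v matrix_vector_mult_diff_distrib vector_scalar_commute
            vector_ssub_ldistrib vector_smult_assoc mult.commute)
      with step.IH have Mv: "M *v v = m *s v" by simp
      then have "N *v v = (l - m) *s v"
        using v by (simp add: matrix_vector_mult_add_rdistrib vec_eq_iff algebra_simps)
      moreover have "Re (l - m) \<le> 0"
        using M neg step.hyps by (force simp: positive_stable_def)
      ultimately show "v = 0"
        using N unfolding positive_stable_def matrix_eigenvalue_def by (meson not_le)
    qed
  qed simp
  with l show False by (auto simp: matrix_eigenvalue_def)
qed

subsection \<open>Commuting matrices\<close>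

text \<open>The predicate lets the closure rules below act as introduction rules, so that most
  commutation goals are settled by the shape of the term.\<close>

definition commutes :: "complex^'n^'n \<Rightarrow> complex^'n^'n \<Rightarrow> bool" where
  "commutes X Y \<longleftrightarrow> X ** Y = Y ** X"

lemma commutes_sym: "commutes X Y \<Longrightarrow> commutes Y X"
  by (simp add: commutes_def)

lemma commutes_refl [simp]: "commutes X X"
  by (simp add: commutes_def)

lemma commutes_mat [simp]: "commutes X (mat c)"
  by (simp add: commutes_def mat_mult_commute)

lemma commutes_0 [simp]: "commutes X 0"
  by (simp add: commutes_def)

lemma commutes_add: "commutes X Y \<Longrightarrow> commutes X Z \<Longrightarrow> commutes X (Y + Z)"
  by (simp add: commutes_def mm.add_left mm.add_right)

lemma commutes_diff: "commutes X Y \<Longrightarrow> commutes X Z \<Longrightarrow> commutes X (Y - Z)"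
  by (simp add: commutes_def mm.diff_left mm.diff_right)

lemma commutes_mult: "commutes X Y \<Longrightarrow> commutes X Z \<Longrightarrow> commutes X (Y ** Z)"
  unfolding commutes_def by (metis matrix_mul_assoc)

lemma commutes_mat_left [simp]: "commutes (mat c) X"
  by (rule commutes_sym) simp

lemma commutes_add_left: "commutes X Z \<Longrightarrow> commutes Y Z \<Longrightarrow> commutes (X + Y) Z"
  by (simp add: commutes_def mm.add_left mm.add_right)

lemma commutes_diff_left: "commutes X Z \<Longrightarrow> commutes Y Z \<Longrightarrow> commutes (X - Y) Z"
  by (simp add: commutes_def mm.diff_left mm.diff_right)

lemma commutes_scaleR: "commutes X Y \<Longrightarrow> commutes X (r *\<^sub>R Y)"
  by (simp add: commutes_def mm.scaleR_left mm.scaleR_right)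

lemma commutes_power: "commutes X Y \<Longrightarrow> commutes X (matrix_power Y n)"
  by (induction n) (simp_all add: commutes_mult)

lemma commutes_pochhammer: "commutes X Y \<Longrightarrow> commutes X (matrix_pochhammer Y n)"
  by (induction n) (simp_all add: commutes_mult commutes_add)

lemma commutes_inv: "commutes X Y \<Longrightarrow> invertible Y \<Longrightarrow> commutes X (matrix_inv Y)"
  unfolding commutes_def by (rule matrix_inv_commute)

lemma commutes_suminf:
  assumes "summable f" "\<And>n. commutes X (f n)"
  shows "commutes X (suminf f)"
  using assms(2) unfolding commutes_def
  by (simp add: bounded_linear.suminf[OF mm.bounded_linear_right assms(1)]
      bounded_linear.suminf[OF mm.bounded_linear_left assms(1)])

text \<open>Integrability is not assumed: a function that is not integrable has integral 0 by
  convention, and 0 commutes with everything.\<close>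

lemma commutes_integral:
  assumes "\<And>t. t \<in> S \<Longrightarrow> commutes X (f t)"
  shows "commutes X (LBINT t:S. f t)"
proof (cases "set_integrable lborel S f")
  case True
  then have int: "integrable lborel (\<lambda>t. indicator S t *\<^sub>R f t)"
    by (simp add: set_integrable_def)
  have "X ** (indicator S t *\<^sub>R f t) = (indicator S t *\<^sub>R f t) ** X" for t
    using assms[of t] by (auto simp: commutes_def indicator_def)
  then show ?thesis
    unfolding commutes_def set_lebesgue_integral_def
    by (simp add: integral_bounded_linear[OF mm.bounded_linear_right int, symmetric]
        integral_bounded_linear[OF mm.bounded_linear_left int, symmetric])
next
  case False
  then show ?thesis
    by (simp add: set_lebesgue_integral_def set_integrable_def not_integrable_integral_eq)
qed

lemmas commutes_intros = commutes_add commutes_diff commutes_mult commutes_scaleR commutes_power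
  commutes_pochhammer commutes_inv

subsection \<open>Power series and the matrix exponential\<close>

lemma norm_vector_smult: "norm (c *s (v :: complex^'n)) = norm c * norm v"
  by (simp add: norm_vec_def norm_mult L2_set_right_distrib)

text \<open>The decay of exp(-xM) is obtained vector by vector; this turns it into a bound for the
  matrix norm. Only the finiteness of the constant matters.\<close>

lemma norm_matrix_le_columns:
  "norm (X :: complex^'n^'n) \<le> real CARD('n) * (\<Sum>j\<in>UNIV. norm (X *v axis j 1))"
proof -
  have "norm X \<le> (\<Sum>i\<in>UNIV. norm (X $ i))"
    unfolding norm_vec_def[of X] by (rule L2_set_le_sum) simp
  also have "\<dots> \<le> (\<Sum>i\<in>(UNIV::'n set). \<Sum>j\<in>UNIV. norm (X *v axis j 1))"
  proof (rule sum_mono)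
    fix i :: 'n
    have "norm (X $ i) \<le> (\<Sum>j\<in>UNIV. norm (X $ i $ j))"
      unfolding norm_vec_def by (rule L2_set_le_sum) simp
    also have "\<dots> \<le> (\<Sum>j\<in>UNIV. norm (X *v axis j 1))"
    proof (rule sum_mono)
      fix j
      have "X $ i $ j = (X *v axis j 1) $ i"
      proof -
        have "(\<Sum>k\<in>UNIV. X $ i $ k * (if k = j then 1 else 0)) = (\<Sum>k\<in>UNIV. if k = j then X $ i $ k else 0)"
          by (intro sum.cong) auto
        then show ?thesis by (simp add: matrix_vector_mult_def axis_def)
      qed
      then show "norm (X $ i $ j) \<le> norm (X *v axis j 1)"
        using Finite_Cartesian_Product.norm_nth_le[of "X *v axis j 1" i] by simp
    qed
    finally show "norm (X $ i) \<le> (\<Sum>j\<in>UNIV. norm (X *v axis j 1))" .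
  qed
  finally show ?thesis by simp
qed

text \<open>The factor \<open>norm (mat 1)\<close> is there for n = 0: in the Frobenius norm the
  identity of size r has norm sqrt r.\<close>

lemma norm_matrix_power_le: "norm (matrix_power M n) \<le> norm (mat 1 :: complex^'n^'n) * norm (M :: complex^'n^'n) ^ n"
proof (induction n)
  case (Suc n)
  have "norm (matrix_power M (Suc n)) \<le> norm M * norm (matrix_power M n)"
    by (simp add: norm_matrix_mult_le)
  also have "\<dots> \<le> norm M * (norm (mat 1 :: complex^'n^'n) * norm M ^ n)"
    using Suc by (intro mult_left_mono) auto
  finally show ?case by (simp add: mult_ac)
qed simp

lemma matrix_power_scaleR: "matrix_power (r *\<^sub>R M) n = r ^ n *\<^sub>R matrix_power M n"
  by (induction n) (simp_all add: mm.scaleR_left mm.scaleR_right)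

lemma summable_of_factorial_bound:
  fixes k :: "nat \<Rightarrow> 'a::real_normed_vector"
  assumes "\<And>n. norm (k n) \<le> K * c ^ n / fact n"
  shows "summable (\<lambda>n. norm (k n) * r ^ n)"
proof (rule summable_comparison_test')
  show "summable (\<lambda>n. K * (inverse (fact n) * (c * \<bar>r\<bar>) ^ n))"
    by (intro summable_mult summable_exp)
  show "norm (norm (k n) * r ^ n) \<le> K * (inverse (fact n) * (c * \<bar>r\<bar>) ^ n)" for n
    using mult_right_mono[OF assms[of n], of "\<bar>r\<bar> ^ n"]
    by (simp add: power_mult_distrib divide_inverse mult_ac abs_mult power_abs)
qed

lemma summable_power_series:
  fixes k :: "nat \<Rightarrow> 'a::banach"
  assumes "\<And>r. summable (\<lambda>n. norm (k n) * r ^ n)"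
  shows "summable (\<lambda>n. x ^ n *\<^sub>R k n)"
  by (rule summable_norm_cancel) (use assms[of "\<bar>x\<bar>"] in \<open>simp add: power_abs mult.commute\<close>)

text \<open>Termwise differentiation by the M-test on a ball around the origin.\<close>

lemma power_series_has_vector_derivative:
  fixes k :: "nat \<Rightarrow> 'a::banach"
  assumes k: "\<And>r. summable (\<lambda>n. norm (k n) * r ^ n)"
  shows "summable (\<lambda>n. (real n * x ^ (n - 1)) *\<^sub>R k n)" (is ?sum)
    and "((\<lambda>x. \<Sum>n. x ^ n *\<^sub>R k n) has_vector_derivative
           (\<Sum>n. (real n * x ^ (n - 1)) *\<^sub>R k n)) (at x)" (is ?deriv)
proof -
  \<comment> \<open>The radius exceeds |x|, so x is an interior point of the ball. As R \<ge> 1, n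
    R^(n-1) \<le> (2 R)^n reduces the majorant \<open>M\<close> to the hypothesis at radius 2
    R.\<close>
  define R where "R = \<bar>x\<bar> + 1"
  define M where "M n = real n * R ^ (n - 1) * norm (k n)" for n
  define g' where "g' y = (\<Sum>n. (real n * y ^ (n - 1)) *\<^sub>R k n)" for y :: real
  have R: "R \<ge> 1" by (simp add: R_def)
  have sM: "summable M"
  proof (rule summable_comparison_test'[OF k[of "2 * R"]])
    fix n
    have "real n \<le> 2 ^ n" by (rule less_imp_le[OF of_nat_less_two_power])
    then have "real n * R ^ (n - 1) \<le> 2 ^ n * R ^ n"
      using R by (intro mult_mono power_increasing) auto
    then have "M n \<le> (2 ^ n * R ^ n) * norm (k n)"
      unfolding M_def by (rule mult_right_mono) simp
    moreover have "0 \<le> M n" using R by (simp add: M_def)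
    ultimately show "norm (M n) \<le> norm (k n) * (2 * R) ^ n"
      by (simp add: power_mult_distrib mult.commute)
  qed
  have bound: "norm ((real n * y ^ (n - 1)) *\<^sub>R k n) \<le> M n" if "y \<in> ball (0::real) R" for n y
  proof -
    have "\<bar>y\<bar> ^ (n - 1) \<le> R ^ (n - 1)" using that by (intro power_mono) auto
    then have "(real n * \<bar>y\<bar> ^ (n - 1)) * norm (k n) \<le> M n"
      unfolding M_def by (intro mult_right_mono mult_left_mono) auto
    then show ?thesis by (simp add: abs_mult power_abs)
  qed
  have sum': "summable (\<lambda>n. (real n * y ^ (n - 1)) *\<^sub>R k n)" if "y \<in> ball (0::real) R" for y
    using bound[OF that] by (intro summable_comparison_test'[OF sM]) auto
  have x: "x \<in> ball (0::real) R" by (simp add: R_def)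
  show ?sum by (rule sum'[OF x])
  have unif: "uniform_limit (ball (0::real) R) (\<lambda>n (y::real). \<Sum>i<n. (real i * y ^ (i - 1)) *\<^sub>R k i) g' sequentially"
    unfolding g'_def by (rule Weierstrass_m_test[OF bound sM])
  have "\<exists>g. \<forall>y\<in>ball (0::real) R. (\<lambda>n. y ^ n *\<^sub>R k n) sums g y \<and>
      (g has_derivative (\<lambda>h. h *\<^sub>R g' y)) (at y within ball (0::real) R)"
  proof (rule has_derivative_series)
    show "((\<lambda>y. y ^ n *\<^sub>R k n) has_derivative (\<lambda>h. h *\<^sub>R ((real n * y ^ (n - 1)) *\<^sub>R k n)))
        (at y within ball (0::real) R)" for n y
      by (auto intro!: derivative_eq_intros)
  next
    fix e :: real assume "e > 0"
    from uniform_limitD[OF unif this]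
    have "\<forall>\<^sub>F n in sequentially. \<forall>y\<in>ball (0::real) R.
        norm ((\<Sum>i<n. (real i * y ^ (i - 1)) *\<^sub>R k i) - g' y) < e" by (simp add: dist_norm)
    then show "\<forall>\<^sub>F n in sequentially. \<forall>y\<in>ball (0::real) R. \<forall>h.
        norm ((\<Sum>i<n. h *\<^sub>R ((real i * y ^ (i - 1)) *\<^sub>R k i)) - h *\<^sub>R g' y) \<le> e * norm h"
    proof (rule eventually_mono, intro ballI allI)
      fix n y and h :: real
      assume "\<forall>y\<in>ball (0::real) R. norm ((\<Sum>i<n. (real i * y ^ (i - 1)) *\<^sub>R k i) - g' y) < e"
        and "y \<in> ball (0::real) R"
      then have "norm (h *\<^sub>R ((\<Sum>i<n. (real i * y ^ (i - 1)) *\<^sub>R k i) - g' y)) \<le> \<bar>h\<bar> * e"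
        unfolding norm_scaleR real_norm_def by (intro mult_left_mono[OF less_imp_le]) auto
      then show "norm ((\<Sum>i<n. h *\<^sub>R ((real i * y ^ (i - 1)) *\<^sub>R k i)) - h *\<^sub>R g' y) \<le> e * norm h"
        by (simp add: scaleR_right_diff_distrib scaleR_sum_right mult.commute)
    qed
  next
    show "(\<lambda>n. x ^ n *\<^sub>R k n) sums (\<Sum>n. x ^ n *\<^sub>R k n)"
      by (intro summable_sums summable_power_series k)
  qed (use x in auto)
  then obtain g where g: "\<And>y. y \<in> ball (0::real) R \<Longrightarrow> (\<lambda>n. y ^ n *\<^sub>R k n) sums g y"
    "\<And>y. y \<in> ball (0::real) R \<Longrightarrow> (g has_derivative (\<lambda>h. h *\<^sub>R g' y)) (at y within ball (0::real) R)" by blast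
  have "(g has_vector_derivative g' x) (at x)"
    using g(2)[OF x] x unfolding has_vector_derivative_def
    by (simp add: at_within_open[OF x open_ball])
  then show ?deriv
    unfolding g'_def[symmetric]
    by (rule has_vector_derivative_transform_within_open[OF _ open_ball x])
       (use g(1) in \<open>auto simp: sums_iff\<close>)
qed

lemma matrix_exp_series:
  "(\<lambda>n. x ^ n *\<^sub>R ((1 / fact n) *\<^sub>R matrix_power M n)) sums matrix_exp (x *\<^sub>R (M :: complex^'n^'n))"
  and matrix_exp_coeff_summable:
  "summable (\<lambda>n. norm ((1 / fact n) *\<^sub>R matrix_power M n) * r ^ n)"
proof -
  show k: "summable (\<lambda>n. norm ((1 / fact n) *\<^sub>R matrix_power M n) * r ^ n)" for r
  proof (rule summable_of_factorial_bound)
    show "norm ((1 / fact n) *\<^sub>R matrix_power M n)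
        \<le> norm (mat 1 :: complex^'n^'n) * norm M ^ n / fact n" for n
      using divide_right_mono[OF norm_matrix_power_le[of M n], of "fact n"] by simp
  qed
  show "(\<lambda>n. x ^ n *\<^sub>R ((1 / fact n) *\<^sub>R matrix_power M n)) sums matrix_exp (x *\<^sub>R M)"
  proof -
    have "(1 / fact n) *\<^sub>R matrix_power (x *\<^sub>R M) n = x ^ n *\<^sub>R ((1 / fact n) *\<^sub>R matrix_power M n)" for n
      by (simp add: matrix_power_scaleR)
    moreover have "summable (\<lambda>n. x ^ n *\<^sub>R ((1 / fact n) *\<^sub>R matrix_power M n))"
      by (rule summable_power_series, rule k)
    ultimately show ?thesis
      unfolding matrix_exp_def by (simp only: summable_sums)
  qed
qed

lemma matrix_exp_sums: "(\<lambda>n. (1 / fact n) *\<^sub>R matrix_power M n) sums matrix_exp M"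
  using matrix_exp_series[of 1 M] by simp

lemma matrix_exp_has_vector_derivative:
  "((\<lambda>x. matrix_exp (x *\<^sub>R M)) has_vector_derivative M ** matrix_exp (x *\<^sub>R M)) (at x)"
proof -
  let ?k = "\<lambda>n. (1 / fact n) *\<^sub>R matrix_power M n"
  have ser: "matrix_exp (y *\<^sub>R M) = (\<Sum>n. y ^ n *\<^sub>R ?k n)" for y
    by (rule sums_unique[OF matrix_exp_series])
  have "(\<lambda>n. M ** (x ^ n *\<^sub>R ?k n)) sums (M ** matrix_exp (x *\<^sub>R M))"
    by (rule bounded_linear.sums[OF mm.bounded_linear_right matrix_exp_series])
  \<comment> \<open>Index shift: the n-th term of M exp(xM) is the term of index n + 1 in the
    derivative series, whose term of index 0 vanishes.\<close>
  moreover have "M ** (x ^ n *\<^sub>R ?k n) = (real (Suc n) * x ^ (Suc n - 1)) *\<^sub>R ?k (Suc n)" for n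
    by (simp add: mm.scaleR_right field_simps del: of_nat_Suc)
  ultimately have "(\<lambda>n. (real n * x ^ (n - 1)) *\<^sub>R ?k n) sums (M ** matrix_exp (x *\<^sub>R M))"
    using sums_Suc[of "\<lambda>n. (real n * x ^ (n - 1)) *\<^sub>R ?k n"] by simp
  then show ?thesis
    unfolding ser using power_series_has_vector_derivative(2)[of ?k x, OF matrix_exp_coeff_summable]
    by (simp add: sums_iff)
qed

lemma commutes_exp: "commutes X M \<Longrightarrow> commutes X (matrix_exp M)"
  using sums_summable[OF matrix_exp_sums] unfolding matrix_exp_def
  by (rule commutes_suminf) (simp add: commutes_intros)

lemma matrix_exp_0 [simp]: "matrix_exp 0 = (mat 1 :: complex^'n^'n)"
proof -
  have "(1 / fact n) *\<^sub>R matrix_power (0 :: complex^'n^'n) n = (if n = 0 then mat 1 else 0)" for n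
    by (cases n) auto
  then have "(\<lambda>n. (1 / fact n) *\<^sub>R matrix_power (0 :: complex^'n^'n) n) sums mat 1"
    using sums_single[of 0 "\<lambda>n. mat 1 :: complex^'n^'n"] by simp
  then show ?thesis by (rule sums_unique2[OF matrix_exp_sums])
qed

text \<open>The function s |-> exp(-sP) exp(-sQ) exp(s(P+Q)) has derivative 0 and therefore keeps
  its value I from s = 0. Both the inverse of exp P (take Q = 0) and the addition theorem follow,
  without multiplying series.\<close>

lemma matrix_exp_add_aux:
  fixes P Q :: "complex^'n^'n"
  assumes PQ: "commutes P Q"
  shows "matrix_exp (- P) ** matrix_exp (- Q) ** matrix_exp (P + Q) = mat 1"
proof -
  define E where "E M s = matrix_exp (s *\<^sub>R M)" for M :: "complex^'n^'n" and s
  have comm: "commutes X (E M s)" if "commutes X M" for X M s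
    unfolding E_def by (intro commutes_exp commutes_intros that)
  have E': "(E M has_vector_derivative M ** E M s) (at s)" for M s
    unfolding E_def by (rule matrix_exp_has_vector_derivative)
  have deriv: "((\<lambda>s. E (- P) s ** E (- Q) s ** E (P + Q) s) has_vector_derivative 0) (at s)" for s
  proof -
    have "((\<lambda>s. E (- P) s ** E (- Q) s ** E (P + Q) s) has_vector_derivative
       E (- P) s ** E (- Q) s ** ((P + Q) ** E (P + Q) s) +
       (E (- P) s ** (- Q ** E (- Q) s) + (- P) ** E (- P) s ** E (- Q) s) ** E (P + Q) s) (at s)"
      by (intro mm.has_vector_derivative E')
    moreover have "E (- P) s ** E (- Q) s ** ((P + Q) ** E (P + Q) s)
      = (P + Q) ** (E (- P) s ** E (- Q) s) ** E (P + Q) s"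
    proof -
      have "commutes (P + Q) (- P)" "commutes (P + Q) (- Q)"
        using PQ by (auto simp: commutes_def mm.add_left mm.add_right mm.minus_left mm.minus_right)
      then have "commutes (P + Q) (E (- P) s ** E (- Q) s)"
        by (intro commutes_mult comm)
      then show ?thesis by (simp add: commutes_def matrix_mul_assoc)
    qed
    moreover have "E (- P) s ** (- Q ** E (- Q) s) = - Q ** E (- P) s ** E (- Q) s"
    proof -
      have "commutes Q (- P)" using PQ by (auto simp: commutes_def mm.minus_left mm.minus_right)
      then have "commutes Q (E (- P) s)" by (rule comm)
      then show ?thesis by (simp add: commutes_def matrix_mul_assoc mm.minus_left mm.minus_right)
    qed
    ultimately show ?thesis
      by (simp add: matrix_mul_assoc mm.add_left mm.diff_left mm.minus_left algebra_simps)
  qed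
  obtain c where "\<And>s. s \<in> UNIV \<Longrightarrow> E (- P) s ** E (- Q) s ** E (P + Q) s = c"
    by (rule has_vector_derivative_zero_constant[OF convex_UNIV deriv]) (rule that)
  then have "E (- P) 1 ** E (- Q) 1 ** E (P + Q) 1 = E (- P) 0 ** E (- Q) 0 ** E (P + Q) 0"
    by simp
  then show ?thesis unfolding E_def by simp
qed

lemma matrix_exp_minus: "matrix_exp (- P) ** matrix_exp P = mat 1"
  using matrix_exp_add_aux[of P 0] by simp

lemma matrix_exp_add:
  assumes "commutes P Q"
  shows "matrix_exp (P + Q) = matrix_exp P ** matrix_exp Q"
proof -
  \<comment> \<open>The product is evaluated in two ways: the last three factors multiply to I by
    the auxiliary identity, and the first four cancel in pairs.\<close>
  have "matrix_exp P ** (matrix_exp Q ** matrix_exp (- Q)) ** matrix_exp (- P) ** matrix_exp (Q + P)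
    = matrix_exp P ** matrix_exp Q"
    using matrix_exp_add_aux[OF commutes_sym[OF assms]] by (simp add: matrix_mul_assoc[symmetric])
  then show ?thesis
    using matrix_exp_minus[of "- P"] matrix_exp_minus[of "- Q"] by (simp add: add.commute)
qed

lemma bounded_linear_mat: "bounded_linear (mat :: complex \<Rightarrow> complex^'n^'n)"
  by (rule linear_conv_bounded_linear[THEN iffD1])
    (auto intro!: linearI simp: vec_eq_iff mat_def)

lemma mat_scaleR: "mat (r *\<^sub>R c) = r *\<^sub>R (mat c :: complex^'n^'n)"
  by (rule linear_simps(5)[OF bounded_linear_mat])

lemma bounded_linear_smult_left: "bounded_linear (\<lambda>c. c *s (v :: complex^'n))"
  by (rule linear_conv_bounded_linear[THEN iffD1])
    (auto intro!: linearI simp: vec_eq_iff algebra_simps)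

lemma matrix_exp_mat: "matrix_exp (mat c) = (mat (exp c) :: complex^'n^'n)"
proof -
  have pow: "matrix_power (mat c :: complex^'n^'n) n = mat (c ^ n)" for n
    by (induction n) (simp_all add: mat_mult_mat)
  have "(\<lambda>n. mat (c ^ n /\<^sub>R fact n)) sums (mat (exp c) :: complex^'n^'n)"
    by (rule bounded_linear.sums[OF bounded_linear_mat exp_converges])
  moreover have "mat (c ^ n /\<^sub>R fact n) = (1 / fact n) *\<^sub>R matrix_power (mat c :: complex^'n^'n) n" for n
    unfolding pow linear_simps(5)[OF bounded_linear_mat] by (simp add: divide_inverse)
  ultimately have "(\<lambda>n. (1 / fact n) *\<^sub>R matrix_power (mat c :: complex^'n^'n) n) sums mat (exp c)"
    by simp
  then show ?thesis by (rule sums_unique2[OF matrix_exp_sums])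
qed

lemma matrix_exp_eigenvector:
  assumes "M *v v = l *s v"
  shows "matrix_exp M *v v = exp l *s v"
proof -
  have pow: "matrix_power M n *v v = l ^ n *s v" for n
    by (induction n) (simp_all add: matrix_vector_mul_assoc[symmetric] vector_scalar_commute
        assms vector_smult_assoc mult.commute)
  have "(\<lambda>n. ((1 / fact n) *\<^sub>R matrix_power M n) *v v) sums (matrix_exp M *v v)"
    by (rule bounded_linear.sums[OF mv.bounded_linear_left matrix_exp_sums])
  moreover have "(\<lambda>n. (l ^ n /\<^sub>R fact n) *s v) sums (exp l *s v)"
    by (rule bounded_linear.sums[OF bounded_linear_smult_left exp_converges])
  moreover have "(l ^ n /\<^sub>R fact n) *s v = ((1 / fact n) *\<^sub>R matrix_power M n) *v v" for n
    by (simp add: mv.scaleR_left pow vec_eq_iff divide_inverse)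
  ultimately show ?thesis by (simp add: sums_unique2)
qed

lemma matrix_exp_shift:
  "matrix_exp (M + mat c) = mat (exp c) ** matrix_exp (M :: complex^'n^'n)"
  by (simp add: matrix_exp_add matrix_exp_mat mat_mult_commute)

text \<open>For h(x) = exp(x(l - M)) v, the norm of h'(x) is that of exp(x(l - M)) (M v - l v),
  which the induction hypothesis bounds by a multiple of exp((Re l - d) x). Integrating and dividing
  by exp(x Re l) yields the decay of exp(-xM) v.\<close>

lemma matrix_exp_decay_vector:
  fixes M :: "complex^'n^'n"
  assumes "positive_stable M"
  shows "\<exists>C\<ge>0. \<exists>d>0. \<forall>x\<ge>0. norm (matrix_exp ((- x) *\<^sub>R M) *v v) \<le> C * exp (- d * x)"
proof (induction v rule: eigen_induct[of _ M])
  case zero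
  show ?case by (rule exI[of _ 0], auto intro!: exI[of _ 1])
next
  case (step v l)
  from step.IH obtain C d where C: "C \<ge> 0" and d: "d > 0" and
    bound: "\<And>x. x \<ge> 0 \<Longrightarrow> norm (matrix_exp ((- x) *\<^sub>R M) *v (M *v v - l *s v)) \<le> C * exp (- d * x)"
    by blast
  have l: "Re l > 0" using assms step.hyps by (auto simp: positive_stable_def)
  \<comment> \<open>The rate is lowered to at most Re l / 2. Then Re l - e > 0, so the bound on h'
    has the purely exponential primitive \<open>phi\<close>, and no factor x appears.\<close>
  define e where "e = min d (Re l / 2)"
  have e: "e > 0" "e \<le> d" "e < Re l" using d l by (auto simp: e_def)
  define N where "N = mat l - M"
  define h where "h x = matrix_exp (x *\<^sub>R N) *v v" for x
  have expN: "matrix_exp (x *\<^sub>R N) = mat (exp (of_real x * l)) ** matrix_exp ((- x) *\<^sub>R M)" for x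
  proof -
    have "mat (of_real x * l) = x *\<^sub>R (mat l :: complex^'n^'n)"
      using mat_scaleR[of x l] by (simp add: scaleR_conv_of_real[of x l])
    then have "x *\<^sub>R N = (- x) *\<^sub>R M + mat (of_real x * l)"
      by (simp add: N_def scaleR_right_diff_distrib)
    then show ?thesis by (simp only: matrix_exp_shift)
  qed
  have norm_h: "norm (matrix_exp (x *\<^sub>R N) *v u) = exp (Re l * x) * norm (matrix_exp ((- x) *\<^sub>R M) *v u)" for x u
    unfolding expN matrix_vector_mul_assoc[symmetric] mat_vector_mult norm_vector_smult
    by (simp add: mult.commute)
  define h' where "h' x = matrix_exp (x *\<^sub>R N) *v (N *v v)" for x
  have h': "(h has_vector_derivative h' x) (at x)" for x
  proof -
    have "(h has_vector_derivative (N ** matrix_exp (x *\<^sub>R N)) *v v) (at x)"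
      unfolding h_def
      by (rule bounded_linear.has_vector_derivative[OF mv.bounded_linear_left matrix_exp_has_vector_derivative])
    moreover have "commutes N (matrix_exp (x *\<^sub>R N))" by (intro commutes_exp commutes_intros) simp
    ultimately show ?thesis by (simp add: h'_def commutes_def matrix_vector_mul_assoc)
  qed
  have "norm (h' x) \<le> C * exp ((Re l - e) * x)" if "x \<ge> 0" for x
  proof -
    have "N *v v = - (M *v v - l *s v)" by (simp add: N_def matrix_vector_mult_diff_rdistrib mat_vector_mult)
    then have "norm (h' x) = exp (Re l * x) * norm (matrix_exp ((- x) *\<^sub>R M) *v (M *v v - l *s v))"
      unfolding h'_def norm_h by (simp only: mv.minus_right norm_minus_cancel)
    also have "\<dots> \<le> exp (Re l * x) * (C * exp (- e * x))"
    proof (intro mult_left_mono order.trans[OF bound[OF that]])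
      show "exp (- d * x) \<le> exp (- e * x)" using e that by (simp add: mult_right_mono)
    qed (use C in auto)
    also have "\<dots> = C * exp ((Re l - e) * x)"
      by (simp add: left_diff_distrib exp_diff exp_minus divide_inverse)
    finally show ?thesis .
  qed
  note h'_bound = this
  define D where "D = C / (Re l - e)"
  have D: "D \<ge> 0" using C e by (simp add: D_def)
  define phi where "phi x = D * exp ((Re l - e) * x)" for x
  have h_bound: "norm (h x) \<le> norm v + phi x" if x: "x \<ge> 0" for x
  proof (cases "x = 0")
    case True
    then show ?thesis using D by (simp add: h_def phi_def)
  next
    case False
    have "norm (h x - h 0) \<le> phi x - phi 0"
    proof (rule differentiable_bound_general)
      show "0 < x" using x False by simp
      show "continuous_on {0..x} h"
        using h' by (intro continuous_at_imp_continuous_on ballI) (rule has_vector_derivative_continuous)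
      show "continuous_on {0..x} phi" unfolding phi_def by (intro continuous_intros)
      show "(phi has_vector_derivative C * exp ((Re l - e) * y)) (at y)" for y
        unfolding phi_def has_real_derivative_iff_has_vector_derivative[symmetric] D_def
        using e by (auto intro!: derivative_eq_intros)
    qed (use h' h'_bound in auto)
    moreover have "h 0 = v" by (simp add: h_def)
    moreover have "phi 0 \<ge> 0" using D by (simp add: phi_def)
    ultimately show ?thesis using norm_triangle_sub[of "h x" v] by simp
  qed
  show ?case
  proof (rule exI[of _ "norm v + D"], rule conjI, goal_cases)
    case 2
    show ?case
    proof (rule exI[of _ e], intro conjI allI impI)
    fix x :: real assume x: "x \<ge> 0"
    have "norm (matrix_exp ((- x) *\<^sub>R M) *v v) = exp (- Re l * x) * norm (h x)"
      unfolding h_def norm_h by (simp add: exp_minus)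
    also have "\<dots> \<le> exp (- Re l * x) * (norm v + phi x)"
      using h_bound[OF x] by simp
    also have "\<dots> = norm v * exp (- Re l * x) + D * exp (- e * x)"
      by (simp add: phi_def algebra_simps exp_diff exp_minus divide_inverse)
    also have "\<dots> \<le> norm v * exp (- e * x) + D * exp (- e * x)"
      using e x by (intro add_right_mono mult_left_mono) (auto intro: mult_right_mono)
    finally show "norm (matrix_exp ((- x) *\<^sub>R M) *v v) \<le> (norm v + D) * exp (- e * x)"
      by (simp add: distrib_right)
    qed (use e in auto)
  qed (use D in auto)
qed

lemma matrix_exp_decay:
  fixes M :: "complex^'n^'n"
  assumes "positive_stable M"
  obtains C d where "C \<ge> 0" "d > 0" "\<And>x. x \<ge> 0 \<Longrightarrow> norm (matrix_exp ((- x) *\<^sub>R M)) \<le> C * exp (- d * x)"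
proof -
  have "\<forall>j. \<exists>C d. C \<ge> 0 \<and> d > 0 \<and> (\<forall>x\<ge>0. norm (matrix_exp ((- x) *\<^sub>R M) *v axis j 1) \<le> C * exp (- d * x))"
    using matrix_exp_decay_vector[OF assms] by blast
  then obtain C d where C: "\<And>j. C j \<ge> 0" and d: "\<And>j. d j > 0" and
    bound: "\<And>j x. x \<ge> 0 \<Longrightarrow> norm (matrix_exp ((- x) *\<^sub>R M) *v axis j 1) \<le> C j * exp (- d j * x)"
    by metis
  define e where "e = Min (range d)"
  have e: "e > 0" "\<And>j. e \<le> d j" using d by (auto simp: e_def)
  show ?thesis
  proof (rule that)
    show "real CARD('n) * (\<Sum>j\<in>UNIV. C j) \<ge> 0" using C by (simp add: sum_nonneg)
    show "e > 0" by fact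
    fix x :: real assume x: "x \<ge> 0"
    have "norm (matrix_exp ((- x) *\<^sub>R M) *v axis j 1) \<le> C j * exp (- e * x)" for j
    proof (rule order.trans[OF bound[OF x]])
      show "C j * exp (- d j * x) \<le> C j * exp (- e * x)"
        using C e(2)[of j] x by (intro mult_left_mono) (auto intro: mult_right_mono)
    qed
    then have "(\<Sum>j\<in>UNIV. norm (matrix_exp ((- x) *\<^sub>R M) *v axis j 1)) \<le> (\<Sum>j\<in>UNIV. C j * exp (- e * x))"
      by (rule sum_mono)
    then have "real CARD('n) * (\<Sum>j\<in>UNIV. norm (matrix_exp ((- x) *\<^sub>R M) *v axis j 1))
        \<le> real CARD('n) * (\<Sum>j\<in>UNIV. C j * exp (- e * x))"
      by (rule mult_left_mono) simp
    then have "norm (matrix_exp ((- x) *\<^sub>R M)) \<le> real CARD('n) * (\<Sum>j\<in>UNIV. C j * exp (- e * x))"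
      using norm_matrix_le_columns by (rule order.trans[rotated])
    then show "norm (matrix_exp ((- x) *\<^sub>R M)) \<le> real CARD('n) * (\<Sum>j\<in>UNIV. C j) * exp (- e * x)"
      by (simp add: sum_distrib_right mult.assoc)
  qed
qed

subsection \<open>Boundedness of the confluent hypergeometric function\<close>

text \<open>In finite dimension a left inverse is two-sided, so one product determines the
  inverse.\<close>

lemma matrix_inv_unique:
  fixes M N :: "complex^'n^'n"
  assumes "N ** M = mat 1"
  shows "matrix_inv M = N"
proof -
  have "invertible M" using assms invertible_left_inverse by blast
  then have "N = N ** (M ** matrix_inv M)" by (simp add: matrix_mult_inv)
  also have "\<dots> = matrix_inv M" by (simp add: matrix_mul_assoc assms)
  finally show ?thesis by simp
qed

lemma matrix_inv_prod:
  fixes M N :: "complex^'n^'n"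
  assumes "invertible M" "invertible N"
  shows "matrix_inv (M ** N) = matrix_inv N ** matrix_inv M"
proof (rule matrix_inv_unique)
  have "matrix_inv N ** matrix_inv M ** (M ** N) = matrix_inv N ** (matrix_inv M ** M) ** N"
    by (simp add: matrix_mul_assoc)
  then show "matrix_inv N ** matrix_inv M ** (M ** N) = mat 1"
    using assms by (simp add: matrix_inv_mult)
qed

lemma positive_stable_shift_invertible:
  "positive_stable B \<Longrightarrow> invertible (B + mat (of_nat n) :: complex^'n^'n)"
  by (rule positive_stable_invertible) (simp add: positive_stable_add_mat)

lemma invertible_pochhammer:
  "positive_stable B \<Longrightarrow> invertible (matrix_pochhammer B n :: complex^'n^'n)"
proof (induction n)
  case 0
  show ?case by (auto simp: invertible_iff_ker)
next
  case (Suc n)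
  then show ?case
    by (simp add: invertible_mult positive_stable_shift_invertible)
qed

text \<open>For large n the identity n R = I - B R, with R = (B + n)^(-1), gives (n - |B|) |R| \<le>
  |I|. The finitely many remaining norms are simply added to the bound.\<close>

lemma resolvent_bounded:
  fixes B :: "complex^'n^'n"
  assumes "positive_stable B"
  obtains K where "\<And>n::nat. norm (matrix_inv (B + mat (of_nat n))) \<le> K"
proof -
  define R where "R n = matrix_inv (B + mat (of_nat n))" for n :: nat
  define N where "N = nat \<lceil>norm B + 1\<rceil>"
  let ?I = "mat 1 :: complex^'n^'n"
  have large: "norm (R n) \<le> norm ?I" if "n > N" for n
  proof -
    have n: "real n \<ge> norm B + 1" using that unfolding N_def by linarith
    have "(B + mat (of_nat n)) ** R n = ?I"
      unfolding R_def by (intro matrix_mult_inv positive_stable_shift_invertible assms)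
    then have "mat (of_real (real n)) ** R n = ?I - B ** R n"
      by (simp add: mm.add_left algebra_simps)
    then have "real n *\<^sub>R R n = ?I - B ** R n" unfolding mat_of_real_mult .
    moreover have "norm (real n *\<^sub>R R n) = real n * norm (R n)" by simp
    ultimately have "real n * norm (R n) = norm (?I - B ** R n)" by (simp only:)
    also have "\<dots> \<le> norm ?I + norm B * norm (R n)"
      by (rule order.trans[OF norm_triangle_ineq4]) (simp add: norm_matrix_mult_le)
    finally have "(real n - norm B) * norm (R n) \<le> norm ?I" by (simp add: algebra_simps)
    moreover have "1 * norm (R n) \<le> (real n - norm B) * norm (R n)"
      using n by (intro mult_right_mono) auto
    ultimately show ?thesis by simp
  qed
  have "norm (R n) \<le> norm ?I + (\<Sum>m\<le>N. norm (R m))" for n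
  proof (cases "n \<le> N")
    case True
    then have "norm (R n) \<le> (\<Sum>m\<le>N. norm (R m))" by (intro member_le_sum) auto
    then show ?thesis using norm_ge_zero[of ?I] by linarith
  next
    case False
    then have "norm (R n) \<le> norm ?I" using large by simp
    moreover have "(\<Sum>m\<le>N. norm (R m)) \<ge> 0" by (simp add: sum_nonneg)
    ultimately show ?thesis by linarith
  qed
  then show ?thesis using that unfolding R_def by blast
qed

text \<open>The Taylor coefficient of order n of x |-> 1F1(A; B; xZ) in the real variable x.\<close>

definition hyp_coeff :: "complex^'n^'n \<Rightarrow> complex^'n^'n \<Rightarrow> complex^'n^'n \<Rightarrow> nat \<Rightarrow> complex^'n^'n" where
  "hyp_coeff A B Z n = matrix_pochhammer A n ** matrix_inv (matrix_pochhammer B n)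
     ** ((1 / fact n) *\<^sub>R matrix_power Z n)"

lemma pochhammer_quotient_Suc:
  fixes A B :: "complex^'n^'n"
  assumes B: "positive_stable B" and AB: "commutes A B"
  defines "c n \<equiv> matrix_pochhammer A n ** matrix_inv (matrix_pochhammer B n)"
  shows "c (Suc n) = c n ** ((A + mat (of_nat n)) ** matrix_inv (B + mat (of_nat n)))"
proof -
  note inv = positive_stable_shift_invertible[OF B] invertible_pochhammer[OF B]
  have "commutes (B + mat (of_nat n)) (matrix_pochhammer B n)"
    by (intro commutes_pochhammer commutes_add_left commutes_refl commutes_mat_left)
  then have "matrix_inv (matrix_pochhammer B (Suc n))
      = matrix_inv (matrix_pochhammer B n) ** matrix_inv (B + mat (of_nat n))"
    unfolding commutes_def by (simp add: inv flip: matrix_inv_prod)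
  moreover have "commutes (A + mat (of_nat n)) (matrix_inv (matrix_pochhammer B n))"
    by (intro commutes_inv commutes_pochhammer inv commutes_add_left AB commutes_mat_left)
  ultimately show ?thesis
    unfolding c_def commutes_def by (simp add: matrix_mul_assoc) (simp flip: matrix_mul_assoc)
qed

text \<open>The ratio (A + n)(B + n)^(-1) = I + (A - B)(B + n)^(-1) is bounded in n. So the
  Pochhammer quotient grows at most geometrically, and the factorial makes the series entire in
  x.\<close>

lemma hyp_coeff_bound:
  fixes A B Z :: "complex^'n^'n"
  assumes B: "positive_stable B" and AB: "commutes A B"
  obtains K c where "K \<ge> 0" "c \<ge> 0" "\<And>n. norm (hyp_coeff A B Z n) \<le> K * c ^ n / fact n"
proof -
  let ?I = "mat 1 :: complex^'n^'n"
  define c where "c n = matrix_pochhammer A n ** matrix_inv (matrix_pochhammer B n)" for n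
  obtain K0 where K0: "\<And>n. norm (matrix_inv (B + mat (of_nat n))) \<le> K0"
    using resolvent_bounded[OF B] by blast
  define K where "K = norm ?I + norm (A - B) * K0"
  have "norm ((A + mat (of_nat n)) ** matrix_inv (B + mat (of_nat n))) \<le> K" for n
  proof -
    have "A + mat (of_nat n) = (B + mat (of_nat n)) + (A - B)" by simp
    then have "(A + mat (of_nat n)) ** matrix_inv (B + mat (of_nat n))
        = ?I + (A - B) ** matrix_inv (B + mat (of_nat n))"
      using matrix_mult_inv[OF positive_stable_shift_invertible[OF B], of n] by (simp only: mm.add_left)
    then have "norm ((A + mat (of_nat n)) ** matrix_inv (B + mat (of_nat n)))
        \<le> norm ?I + norm ((A - B) ** matrix_inv (B + mat (of_nat n)))"
      by (simp add: norm_triangle_ineq)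
    also have "\<dots> \<le> norm ?I + norm (A - B) * norm (matrix_inv (B + mat (of_nat n)))"
      by (intro add_left_mono norm_matrix_mult_le)
    also have "\<dots> \<le> K"
      unfolding K_def using K0 by (intro add_left_mono mult_left_mono) auto
    finally show ?thesis .
  qed
  note K = this
  have K_nonneg: "K \<ge> 0" using order.trans[OF norm_ge_zero K[of 0]] .
  have c: "norm (c n) \<le> norm ?I * K ^ n" for n
  proof (induction n)
    case 0
    have "matrix_inv ?I = ?I" by (rule matrix_inv_unique) simp
    then show ?case by (simp add: c_def)
  next
    case (Suc n)
    have "norm (c (Suc n)) \<le> norm (c n) * norm ((A + mat (of_nat n)) ** matrix_inv (B + mat (of_nat n)))"
      unfolding c_def pochhammer_quotient_Suc[OF B AB] by (rule norm_matrix_mult_le)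
    also have "\<dots> \<le> (norm ?I * K ^ n) * K"
      using Suc K K_nonneg by (intro mult_mono) auto
    finally show ?case by (simp add: mult_ac)
  qed
  show ?thesis
  proof (rule that)
    show "norm ?I * norm ?I \<ge> 0" by simp
    show "K * norm Z \<ge> 0" using K_nonneg by simp
    fix n
    have "norm (hyp_coeff A B Z n) \<le> norm (c n) * norm ((1 / fact n) *\<^sub>R matrix_power Z n)"
      unfolding hyp_coeff_def c_def by (rule norm_matrix_mult_le)
    also have "\<dots> \<le> (norm ?I * K ^ n) * ((norm ?I * norm Z ^ n) / fact n)"
      using K_nonneg divide_right_mono[OF norm_matrix_power_le[of Z n], of "fact n"]
      by (intro mult_mono c) auto
    finally show "norm (hyp_coeff A B Z n) \<le> norm ?I * norm ?I * (K * norm Z) ^ n / fact n"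
      by (simp add: power_mult_distrib mult_ac)
  qed
qed

text \<open>This is Kummer's equation read off coefficient by coefficient. The commutation
  hypotheses allow the new factors to be collected on the left.\<close>

lemma hyp_coeff_rec:
  fixes A B Z :: "complex^'n^'n"
  assumes B: "positive_stable B" and AB: "commutes A B" and AZ: "commutes A Z" and BZ: "commutes B Z"
  shows "real (Suc n) *\<^sub>R ((B + mat (of_nat n)) ** hyp_coeff A B Z (Suc n))
    = (A + mat (of_nat n)) ** Z ** hyp_coeff A B Z n"
proof -
  define c where "c n = matrix_pochhammer A n ** matrix_inv (matrix_pochhammer B n)" for n
  define a b r w where "a = A + mat (of_nat n)" and "b = B + mat (of_nat n)" and "r = matrix_inv b"
    and "w = (1 / fact n) *\<^sub>R matrix_power Z n"
  note inv = positive_stable_shift_invertible[OF B] invertible_pochhammer[OF B]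
  have br: "b ** r = mat 1" unfolding b_def r_def by (intro matrix_mult_inv inv)
  have c: "c (Suc n) = c n ** (a ** r)"
    unfolding c_def a_def r_def b_def by (rule pochhammer_quotient_Suc[OF B AB])
  have c_comm: "commutes X (c n)" if "commutes X A" "commutes X B" for X
    unfolding c_def by (intro commutes_mult commutes_inv commutes_pochhammer that inv)
  note sym = commutes_sym[OF AB] commutes_sym[OF AZ] commutes_sym[OF BZ]
  have bc: "commutes b (c n)"
    unfolding b_def by (intro c_comm commutes_add_left sym commutes_refl commutes_mat_left)
  have ac: "commutes a (c n)"
    unfolding a_def by (intro c_comm commutes_add_left AB commutes_refl commutes_mat_left)
  have Zc: "commutes Z (c n)"
    by (intro c_comm sym)
  have ab: "commutes b a"
    unfolding a_def b_def
    by (intro commutes_add commutes_add_left commutes_mat commutes_mat_left sym)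
  have "real (Suc n) *\<^sub>R (b ** hyp_coeff A B Z (Suc n))
      = b ** (c (Suc n) ** (real (Suc n) *\<^sub>R ((1 / fact (Suc n)) *\<^sub>R (Z ** matrix_power Z n))))"
    by (simp add: hyp_coeff_def c_def mm.scaleR_right)
  also have "real (Suc n) *\<^sub>R ((1 / fact (Suc n)) *\<^sub>R (Z ** matrix_power Z n)) = Z ** w"
    unfolding w_def by (simp add: mm.scaleR_right field_simps del: of_nat_Suc)
  also have "b ** (c (Suc n) ** (Z ** w)) = (b ** c n) ** a ** r ** Z ** w"
    by (simp add: c matrix_mul_assoc)
  also have "\<dots> = c n ** (b ** a) ** r ** Z ** w"
    using bc by (simp add: commutes_def matrix_mul_assoc)
  also have "\<dots> = c n ** a ** (b ** r) ** Z ** w"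
    using ab by (simp add: commutes_def matrix_mul_assoc)
  also have "\<dots> = (c n ** a) ** Z ** w" by (simp add: br)
  also have "\<dots> = a ** (c n ** Z) ** w" using ac by (simp add: commutes_def matrix_mul_assoc)
  also have "c n ** Z = Z ** c n" using Zc by (simp add: commutes_def)
  also have "a ** (Z ** c n) ** w = a ** Z ** (c n ** w)" by (simp add: matrix_mul_assoc)
  finally show ?thesis
    by (simp add: a_def b_def hyp_coeff_def c_def w_def)
qed

lemma hyp_coeff_summable:
  assumes "positive_stable B" "commutes A B"
  shows "summable (\<lambda>n. norm (hyp_coeff A B Z n) * r ^ n)"
proof -
  obtain K c where "\<And>n. norm (hyp_coeff A B Z n) \<le> K * c ^ n / fact n"
    using hyp_coeff_bound[OF assms, of Z] by blast
  then show ?thesis by (rule summable_of_factorial_bound)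
qed

lemma matrix_1F1_sums:
  assumes "positive_stable B" "commutes A B"
  shows "(\<lambda>n. x ^ n *\<^sub>R hyp_coeff A B Z n) sums matrix_1F1 A B (x *\<^sub>R Z)"
proof -
  have "(\<lambda>n. matrix_pochhammer A n ** matrix_inv (matrix_pochhammer B n)
      ** ((1 / fact n) *\<^sub>R matrix_power (x *\<^sub>R Z) n)) = (\<lambda>n. x ^ n *\<^sub>R hyp_coeff A B Z n)"
    by (simp add: hyp_coeff_def matrix_power_scaleR mm.scaleR_right mult.commute)
  then show ?thesis
    unfolding matrix_1F1_def
    by (simp add: summable_sums summable_power_series hyp_coeff_summable[OF assms])
qed

lemma commutes_1F1:
  assumes "positive_stable B" "commutes A B" "commutes X A" "commutes X B" "commutes X Z"
  shows "commutes X (matrix_1F1 A B Z)"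
proof -
  have "summable (hyp_coeff A B Z)"
    using matrix_1F1_sums[OF assms(1,2), of 1 Z] by (simp add: sums_iff)
  moreover have "commutes X (hyp_coeff A B Z n)" for n
    unfolding hyp_coeff_def by (intro commutes_intros assms invertible_pochhammer)
  moreover have "matrix_1F1 A B Z = suminf (hyp_coeff A B Z)"
    by (simp add: matrix_1F1_def hyp_coeff_def[abs_def])
  ultimately show ?thesis by (simp add: commutes_suminf)
qed

lemma continuous_on_1F1:
  assumes "positive_stable B" "commutes A B"
  shows "continuous_on UNIV (\<lambda>x. matrix_1F1 A B (x *\<^sub>R Z))"
proof -
  have "matrix_1F1 A B (x *\<^sub>R Z) = (\<Sum>n. x ^ n *\<^sub>R hyp_coeff A B Z n)" for x
    by (rule sums_unique[OF matrix_1F1_sums[OF assms]])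
  then show ?thesis
    using power_series_has_vector_derivative(2)[OF hyp_coeff_summable[OF assms, of Z]]
    by (intro continuous_at_imp_continuous_on ballI) (auto intro: has_vector_derivative_continuous)
qed

text \<open>Here \<open>g = (\<theta> + A) f\<close> with \<open>\<theta> = x d/dx\<close>.\<close>

lemma kummer_system:
  fixes A B Z :: "complex^'n^'n"
  assumes B: "positive_stable B" and AB: "commutes A B" and AZ: "commutes A Z" and BZ: "commutes B Z"
  defines "f x \<equiv> matrix_1F1 A B (x *\<^sub>R Z)"
  obtains g where
    "\<And>x. x > 0 \<Longrightarrow> (f has_vector_derivative (1 / x) *\<^sub>R (g x - A ** f x)) (at x)"
    "\<And>x. x > 0 \<Longrightarrow> (g has_vector_derivative
        (1 / x) *\<^sub>R ((mat 1 + A - B) ** (g x - A ** f x)) + Z ** g x) (at x)"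
proof -
  define k where "k = hyp_coeff A B Z"
  \<comment> \<open>The Taylor coefficients of g: theta multiplies the coefficient of order n by
    n.\<close>
  define l where "l n = real n *\<^sub>R k n + A ** k n" for n
  define D where "D h x = (\<Sum>n. (real n * x ^ (n - 1)) *\<^sub>R h n)" for h :: "nat \<Rightarrow> complex^'n^'n" and x
  define g where "g x = (\<Sum>n. x ^ n *\<^sub>R l n)" for x
  have k_sum: "summable (\<lambda>n. norm (k n) * r ^ n)" for r
    unfolding k_def by (rule hyp_coeff_summable[OF B AB])
  have l_sum: "summable (\<lambda>n. norm (l n) * r ^ n)" for r
  proof -
    obtain K c where Kc: "K \<ge> 0" "c \<ge> 0" "\<And>n. norm (k n) \<le> K * c ^ n / fact n"
      unfolding k_def using hyp_coeff_bound[OF B AB, of Z] by blast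
    have "norm (l n) \<le> ((1 + norm A) * K) * (2 * c) ^ n / fact n" for n
    proof -
      have "real n \<le> 2 ^ n" by (rule less_imp_le[OF of_nat_less_two_power])
      moreover have "norm A * 1 \<le> norm A * 2 ^ n" by (intro mult_left_mono) auto
      ultimately have n: "real n + norm A \<le> (1 + norm A) * 2 ^ n" unfolding distrib_right by linarith
      have "norm (l n) \<le> real n * norm (k n) + norm A * norm (k n)"
        unfolding l_def by (rule order.trans[OF norm_triangle_ineq]) (simp add: norm_matrix_mult_le)
      also have "\<dots> = (real n + norm A) * norm (k n)" by (simp add: distrib_right)
      also have "\<dots> \<le> ((1 + norm A) * 2 ^ n) * (K * c ^ n / fact n)"
        using Kc n by (intro mult_mono) auto
      finally show ?thesis by (simp add: power_mult_distrib mult_ac)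
    qed
    then show ?thesis by (rule summable_of_factorial_bound)
  qed
  have f_sums: "(\<lambda>n. x ^ n *\<^sub>R k n) sums f x" for x
    unfolding k_def f_def by (rule matrix_1F1_sums[OF B AB])
  have g_sums: "(\<lambda>n. x ^ n *\<^sub>R l n) sums g x" for x
    unfolding g_def by (intro summable_sums summable_power_series l_sum)
  have f': "(f has_vector_derivative D k x) (at x)" for x
  proof -
    have "f = (\<lambda>x. \<Sum>n. x ^ n *\<^sub>R k n)" using f_sums by (auto simp: sums_iff)
    then show ?thesis unfolding D_def using power_series_has_vector_derivative(2)[OF k_sum] by simp
  qed
  have g': "(g has_vector_derivative D l x) (at x)" for x
    unfolding D_def g_def by (rule power_series_has_vector_derivative(2)[OF l_sum])
  have D_sums: "(\<lambda>n. (real n * x ^ n) *\<^sub>R h n) sums (x *\<^sub>R D h x)"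
    if "\<And>r. summable (\<lambda>n. norm (h n) * r ^ n)" for h x
  proof -
    have "(\<lambda>n. x *\<^sub>R ((real n * x ^ (n - 1)) *\<^sub>R h n)) sums (x *\<^sub>R D h x)"
      unfolding D_def by (intro sums_scaleR_right summable_sums power_series_has_vector_derivative(1) that)
    moreover have "x * (real n * x ^ (n - 1)) = real n * x ^ n" for n by (cases n) auto
    ultimately show ?thesis by (simp only: scaleR_scaleR)
  qed
  have g_eq: "x *\<^sub>R D k x = g x - A ** f x" for x
  proof -
    have "(\<lambda>n. (real n * x ^ n) *\<^sub>R k n + A ** (x ^ n *\<^sub>R k n)) sums (x *\<^sub>R D k x + A ** f x)"
      by (intro sums_add D_sums k_sum bounded_linear.sums[OF mm.bounded_linear_right f_sums])
    moreover have "(real n * x ^ n) *\<^sub>R k n + A ** (x ^ n *\<^sub>R k n) = x ^ n *\<^sub>R l n" for n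
      by (simp add: l_def mm.scaleR_right scaleR_add_right mult.commute)
    ultimately have "x *\<^sub>R D k x + A ** f x = g x"
      using g_sums[of x] by (simp add: sums_iff)
    then show ?thesis by (simp add: algebra_simps)
  qed
  \<comment> \<open>The coefficients of theta g = (1 + A - B) theta f + x Z g. Splitting n + 1 + A
    as (1 + A - B) + (B + n), the second part is given by the recurrence
    \<open>hyp_coeff_rec\<close>.\<close>
  have coeff: "real (Suc n) *\<^sub>R l (Suc n) = (mat 1 + A - B) ** (real (Suc n) *\<^sub>R k (Suc n)) + Z ** l n" for n
  proof -
    have "Z ** l n = (A + mat (of_nat n)) ** Z ** k n"
    proof -
      have "mat (of_nat n) ** (Z ** k n) = real n *\<^sub>R (Z ** k n)"
        using mat_of_real_mult[of "real n" "Z ** k n"] by simp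
      moreover have "A ** (Z ** k n) = Z ** (A ** k n)"
        using AZ by (simp add: commutes_def matrix_mul_assoc)
      ultimately show ?thesis
        unfolding l_def
        by (simp add: mm.add_right mm.add_left mm.scaleR_right flip: matrix_mul_assoc)
    qed
    also have "\<dots> = real (Suc n) *\<^sub>R ((B + mat (of_nat n)) ** k (Suc n))"
      unfolding k_def by (rule hyp_coeff_rec[OF B AB AZ BZ, symmetric])
    also have "\<dots> = real (Suc n) *\<^sub>R (B ** k (Suc n) + real n *\<^sub>R k (Suc n))"
      using mat_of_real_mult[of "real n" "k (Suc n)"] by (simp add: mm.add_left)
    finally show ?thesis
      by (simp add: l_def mm.add_left mm.diff_left mm.add_right mm.scaleR_right algebra_simps)
  qed
  have g'_eq: "x *\<^sub>R D l x = (mat 1 + A - B) ** (g x - A ** f x) + x *\<^sub>R (Z ** g x)" for x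
  proof -
    have "(\<lambda>n. (mat 1 + A - B) ** ((real n * x ^ n) *\<^sub>R k n)) sums ((mat 1 + A - B) ** (x *\<^sub>R D k x))"
      by (intro bounded_linear.sums[OF mm.bounded_linear_right] D_sums k_sum)
    moreover have "(\<lambda>n. x *\<^sub>R (Z ** (x ^ n *\<^sub>R l n))) sums (x *\<^sub>R (Z ** g x))"
      by (intro sums_scaleR_right bounded_linear.sums[OF mm.bounded_linear_right] g_sums)
    \<comment> \<open>The function x Z g has no constant term; the case distinction aligns its
      series with the other two.\<close>
    then have "(\<lambda>n. case n of 0 \<Rightarrow> 0 | Suc n \<Rightarrow> x *\<^sub>R (Z ** (x ^ n *\<^sub>R l n))) sums (x *\<^sub>R (Z ** g x))"
      using sums_Suc[of "\<lambda>n. case n of 0 \<Rightarrow> 0 | Suc n \<Rightarrow> x *\<^sub>R (Z ** (x ^ n *\<^sub>R l n))"] by simp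
    ultimately have "(\<lambda>n. (mat 1 + A - B) ** ((real n * x ^ n) *\<^sub>R k n)
        + (case n of 0 \<Rightarrow> 0 | Suc n \<Rightarrow> x *\<^sub>R (Z ** (x ^ n *\<^sub>R l n))))
        sums ((mat 1 + A - B) ** (x *\<^sub>R D k x) + x *\<^sub>R (Z ** g x))"
      by (rule sums_add)
    moreover have "(mat 1 + A - B) ** ((real n * x ^ n) *\<^sub>R k n)
        + (case n of 0 \<Rightarrow> 0 | Suc n \<Rightarrow> x *\<^sub>R (Z ** (x ^ n *\<^sub>R l n))) = (real n * x ^ n) *\<^sub>R l n" for n
    proof (cases n)
      case (Suc m)
      have "(real (Suc m) * x ^ Suc m) *\<^sub>R l (Suc m) = x ^ Suc m *\<^sub>R (real (Suc m) *\<^sub>R l (Suc m))"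
        by (simp only: scaleR_scaleR mult.commute)
      also have "\<dots> = (mat 1 + A - B) ** ((real (Suc m) * x ^ Suc m) *\<^sub>R k (Suc m))
          + x *\<^sub>R (Z ** (x ^ m *\<^sub>R l m))"
        unfolding coeff by (simp add: mm.scaleR_right scaleR_add_right mult.commute del: of_nat_Suc)
      finally show ?thesis by (simp add: Suc)
    qed simp
    ultimately have "(\<lambda>n. (real n * x ^ n) *\<^sub>R l n) sums ((mat 1 + A - B) ** (x *\<^sub>R D k x) + x *\<^sub>R (Z ** g x))"
      by simp
    then have "x *\<^sub>R D l x = (mat 1 + A - B) ** (x *\<^sub>R D k x) + x *\<^sub>R (Z ** g x)"
      by (rule sums_unique2[OF D_sums[OF l_sum]])
    then show ?thesis by (simp only: g_eq)
  qed
  show ?thesis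
  proof (rule that[of g])
    fix x :: real assume x: "x > 0"
    have "D k x = (1 / x) *\<^sub>R (x *\<^sub>R D k x)" using x by simp
    then show "(f has_vector_derivative (1 / x) *\<^sub>R (g x - A ** f x)) (at x)"
      using f'[of x] unfolding g_eq by simp
    have "D l x = (1 / x) *\<^sub>R (x *\<^sub>R D l x)" using x by simp
    also have "\<dots> = (1 / x) *\<^sub>R ((mat 1 + A - B) ** (g x - A ** f x)) + Z ** g x"
      unfolding g'_eq using x by (simp add: scaleR_add_right)
    finally show "(g has_vector_derivative
        (1 / x) *\<^sub>R ((mat 1 + A - B) ** (g x - A ** f x)) + Z ** g x) (at x)"
      using g'[of x] by simp
  qed
qed

text \<open>K enters g' only with the factor 1/x, so far out g is a small perturbation of the
  decaying mode exp(-xY). The proof is a bootstrap: the maximum of |g| over [x0, x] is at most half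
  of itself plus data at x0.\<close>

lemma bounded_of_kummer_system:
  fixes f g :: "real \<Rightarrow> complex^'n^'n"
  assumes A: "positive_stable A" and Y: "positive_stable Y"
    and f': "\<And>x. x > 0 \<Longrightarrow> (f has_vector_derivative (1 / x) *\<^sub>R (g x - A ** f x)) (at x)"
    and g': "\<And>x. x > 0 \<Longrightarrow> (g has_vector_derivative (1 / x) *\<^sub>R (K ** (g x - A ** f x)) - Y ** g x) (at x)"
  obtains M x0 where "x0 > 0" "\<And>x. x \<ge> x0 \<Longrightarrow> norm (f x) \<le> M"
proof -
  obtain CA dA where A': "CA \<ge> 0" "dA > 0"
    "\<And>x. x \<ge> 0 \<Longrightarrow> norm (matrix_exp ((- x) *\<^sub>R A)) \<le> CA * exp (- dA * x)"
    using matrix_exp_decay[OF A] by blast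
  obtain CY dY where Y': "CY \<ge> 0" "dY > 0"
    "\<And>x. x \<ge> 0 \<Longrightarrow> norm (matrix_exp ((- x) *\<^sub>R Y)) \<le> CY * exp (- dY * x)"
    using matrix_exp_decay[OF Y] by blast
  have cont: "continuous_on {a..b} f" "continuous_on {a..b} g" if "a > 0" for a b
    using that
    by (auto intro!: continuous_at_imp_continuous_on
        intro: has_vector_derivative_continuous[OF f'] has_vector_derivative_continuous[OF g'])
  \<comment> \<open>Total masses of the two kernels: CA times the integral of (s/x)^dA ds/s over (0,
    x), and CY |K| times the integral of exp(dY (s - x)) ds over s \<le> x.\<close>
  define b where "b = CA / dA"
  define e where "e = CY * norm K / dY"
  have be: "b \<ge> 0" "e \<ge> 0" using A' Y' by (simp_all add: b_def e_def)
  have f_bound: "norm (f x) \<le> CA * norm (f x0) + b * G"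
    if x0: "x0 > 0" "x0 \<le> x" and G: "\<And>s. s \<in> {x0..x} \<Longrightarrow> norm (g s) \<le> G" for x0 x G
  proof -
    \<comment> \<open>The integrating factor (s/x)^A, normalized to I at s = x so that
      \<open>h x = f x\<close>. \<open>phi\<close> is a primitive of the bound on |h'|; comparing
      derivatives takes the place of the integral in the variation of constants formula.\<close>
    define E where "E s = matrix_exp ((ln s - ln x) *\<^sub>R A)" for s
    define h where "h s = E s ** f s" for s
    define phi where "phi s = b * G * exp (dA * (ln s - ln x))" for s
    have E: "norm (E s) \<le> CA * exp (dA * (ln s - ln x))" if "s > 0" "s \<le> x" for s
      using A'(3)[of "ln x - ln s"] that unfolding E_def by (simp add: algebra_simps)
    have G0: "G \<ge> 0" using order.trans[OF norm_ge_zero G[of x0]] x0 by simp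
    have E': "(E has_vector_derivative (1 / s) *\<^sub>R (A ** E s)) (at s)" if "s > 0" for s
    proof -
      have "((\<lambda>s. ln s - ln x) has_vector_derivative 1 / s) (at s)"
        unfolding has_real_derivative_iff_has_vector_derivative[symmetric]
        using that by (auto intro!: derivative_eq_intros)
      from vector_diff_chain_at[OF this matrix_exp_has_vector_derivative[of A]]
      show ?thesis by (simp add: E_def[abs_def] o_def)
    qed
    have h': "(h has_vector_derivative (1 / s) *\<^sub>R (E s ** g s)) (at s)" if "s > 0" for s
    proof -
      have AE: "A ** E s = E s ** A"
        using commutes_exp[OF commutes_scaleR[OF commutes_refl]] by (simp add: E_def commutes_def)
      have "(h has_vector_derivative E s ** ((1 / s) *\<^sub>R (g s - A ** f s)) + (1 / s) *\<^sub>R (A ** E s) ** f s) (at s)"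
        unfolding h_def by (intro mm.has_vector_derivative E' f' that)
      also have "E s ** ((1 / s) *\<^sub>R (g s - A ** f s)) + (1 / s) *\<^sub>R (A ** E s) ** f s = (1 / s) *\<^sub>R (E s ** g s)"
        unfolding AE by (simp add: mm.scaleR_left mm.scaleR_right mm.diff_right scaleR_diff_right matrix_mul_assoc)
      finally show ?thesis .
    qed
    have hx: "h x = f x" by (simp add: h_def E_def)
    have "norm (h x0) \<le> norm (E x0) * norm (f x0)" unfolding h_def by (rule norm_matrix_mult_le)
    also have "norm (E x0) \<le> CA * exp (dA * (ln x0 - ln x))" using x0 by (intro E) auto
    also have "\<dots> \<le> CA * 1"
      using A' x0 by (intro mult_left_mono) (auto simp: mult_nonneg_nonpos)
    finally have hx0: "norm (h x0) \<le> CA * norm (f x0)" by (simp add: mult_right_mono)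
    show ?thesis
    proof (cases "x0 = x")
      case True
      then have "norm (f x) \<le> CA * norm (f x0)" using hx hx0 by simp
      then show ?thesis using be G0 by (simp add: add_increasing2)
    next
      case False
      have "norm (h x - h x0) \<le> phi x - phi x0"
      proof (rule differentiable_bound_general)
        show "x0 < x" using False x0 by simp
        show "continuous_on {x0..x} h"
          using x0 by (intro continuous_at_imp_continuous_on ballI)
            (auto intro!: has_vector_derivative_continuous[OF h'])
        show "continuous_on {x0..x} phi"
          unfolding phi_def using x0 by (intro continuous_intros) auto
        fix s assume s: "x0 < s" "s < x"
        then have s0: "s > 0" using x0 by simp
        show "(h has_vector_derivative (1 / s) *\<^sub>R (E s ** g s)) (at s)" by (rule h'[OF s0])
        show "(phi has_vector_derivative (1 / s) * (CA * exp (dA * (ln s - ln x)) * G)) (at s)"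
          unfolding phi_def has_real_derivative_iff_has_vector_derivative[symmetric] b_def
          using s0 A' by (auto intro!: derivative_eq_intros)
        have "norm (E s ** g s) \<le> norm (E s) * norm (g s)" by (rule norm_matrix_mult_le)
        also have "\<dots> \<le> (CA * exp (dA * (ln s - ln x))) * G"
          using s s0 A' by (intro mult_mono E G) auto
        finally show "norm ((1 / s) *\<^sub>R (E s ** g s)) \<le> (1 / s) * (CA * exp (dA * (ln s - ln x)) * G)"
          using s0 by (simp add: divide_right_mono)
      qed
      also have "\<dots> \<le> b * G" using be G0 by (simp add: phi_def)
      finally have "norm (f x - h x0) \<le> b * G" unfolding hx .
      then show ?thesis using norm_triangle_sub[of "f x" "h x0"] hx0 by linarith
    qed
  qed
  have g_bound: "norm (g x) \<le> CY * norm (g x0) + e / x0 * H"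
    if x0: "x0 > 0" "x0 \<le> x" and H: "\<And>s. s \<in> {x0..x} \<Longrightarrow> norm (g s - A ** f s) \<le> H" for x0 x H
  proof -
    \<comment> \<open>The same scheme with exp((s - x) Y). Here 1/s \<le> 1/x0 is taken out, which
      produces the small factor e / x0.\<close>
    define E where "E s = matrix_exp ((s - x) *\<^sub>R Y)" for s
    define h where "h s = E s ** g s" for s
    define phi where "phi s = e / x0 * H * exp (dY * (s - x))" for s
    have E: "norm (E s) \<le> CY * exp (dY * (s - x))" if "s \<le> x" for s
      using Y'(3)[of "x - s"] that unfolding E_def by (simp add: algebra_simps)
    have H0: "H \<ge> 0" using order.trans[OF norm_ge_zero H[of x0]] x0 by simp
    have E': "(E has_vector_derivative Y ** E s) (at s)" for s
    proof -
      have "((\<lambda>s. s - x) has_vector_derivative 1) (at s)"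
        unfolding has_real_derivative_iff_has_vector_derivative[symmetric]
        by (auto intro!: derivative_eq_intros)
      from vector_diff_chain_at[OF this matrix_exp_has_vector_derivative[of Y]]
      show ?thesis by (simp add: E_def[abs_def] o_def)
    qed
    have h': "(h has_vector_derivative (1 / s) *\<^sub>R (E s ** (K ** (g s - A ** f s)))) (at s)" if "s > 0" for s
    proof -
      have YE: "Y ** E s = E s ** Y"
        using commutes_exp[OF commutes_scaleR[OF commutes_refl]] by (simp add: E_def commutes_def)
      have "(h has_vector_derivative E s ** ((1 / s) *\<^sub>R (K ** (g s - A ** f s)) - Y ** g s) + (Y ** E s) ** g s) (at s)"
        unfolding h_def by (intro mm.has_vector_derivative E' g' that)
      also have "E s ** ((1 / s) *\<^sub>R (K ** (g s - A ** f s)) - Y ** g s) + (Y ** E s) ** g s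
          = (1 / s) *\<^sub>R (E s ** (K ** (g s - A ** f s)))"
        unfolding YE mm.diff_right[of "E s"] mm.scaleR_right[of "E s"] by (simp add: matrix_mul_assoc)
      finally show ?thesis .
    qed
    have hx: "h x = g x" by (simp add: h_def E_def)
    have "norm (h x0) \<le> norm (E x0) * norm (g x0)" unfolding h_def by (rule norm_matrix_mult_le)
    also have "norm (E x0) \<le> CY * exp (dY * (x0 - x))" using x0 by (intro E) auto
    also have "\<dots> \<le> CY * 1"
      using Y' x0 by (intro mult_left_mono) (auto simp: mult_nonneg_nonpos)
    finally have hx0: "norm (h x0) \<le> CY * norm (g x0)" by (simp add: mult_right_mono)
    show ?thesis
    proof (cases "x0 = x")
      case True
      then have "norm (g x) \<le> CY * norm (g x0)" using hx hx0 by simp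
      moreover have "e / x0 * H \<ge> 0" using be H0 x0 by simp
      ultimately show ?thesis by linarith
    next
      case False
      have "norm (h x - h x0) \<le> phi x - phi x0"
      proof (rule differentiable_bound_general)
        show "x0 < x" using False x0 by simp
        show "continuous_on {x0..x} h"
          using x0 by (intro continuous_at_imp_continuous_on ballI)
            (auto intro!: has_vector_derivative_continuous[OF h'])
        show "continuous_on {x0..x} phi"
          unfolding phi_def using x0 by (intro continuous_intros) auto
        fix s assume s: "x0 < s" "s < x"
        then have s0: "s > 0" using x0 by simp
        show "(h has_vector_derivative (1 / s) *\<^sub>R (E s ** (K ** (g s - A ** f s)))) (at s)" by (rule h'[OF s0])
        show "(phi has_vector_derivative (1 / x0) * (CY * exp (dY * (s - x)) * (norm K * H))) (at s)"
          unfolding phi_def has_real_derivative_iff_has_vector_derivative[symmetric] e_def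
          using x0 Y' by (auto intro!: derivative_eq_intros)
        have "norm (E s ** (K ** (g s - A ** f s))) \<le> norm (E s) * norm (K ** (g s - A ** f s))"
          by (rule norm_matrix_mult_le)
        also have "\<dots> \<le> (CY * exp (dY * (s - x))) * (norm K * H)"
          using s x0 Y' by (intro mult_mono E order.trans[OF norm_matrix_mult_le] H) auto
        finally have "(1 / s) * norm (E s ** (K ** (g s - A ** f s)))
            \<le> (1 / x0) * (CY * exp (dY * (s - x)) * (norm K * H))"
          using s x0 by (intro mult_mono) (auto simp: frac_le)
        then show "norm ((1 / s) *\<^sub>R (E s ** (K ** (g s - A ** f s))))
            \<le> (1 / x0) * (CY * exp (dY * (s - x)) * (norm K * H))"
          using s0 by simp
      qed
      also have "\<dots> \<le> e / x0 * H" using be H0 x0 by (simp add: phi_def)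
      finally have "norm (g x - h x0) \<le> e / x0 * H" unfolding hx .
      then show ?thesis using norm_triangle_sub[of "g x" "h x0"] hx0 by linarith
    qed
  qed
  \<comment> \<open>From |f| \<le> a + b G follows |g - A f| \<le> c G + |A| a. Then x0 is taken so
    large that the coefficient e c / x0 of G is at most 1/2.\<close>
  define c where "c = 1 + norm A * b"
  have c: "c \<ge> 1" using be by (simp add: c_def)
  define x0 where "x0 = 1 + 2 * e * c"
  have "e * c \<ge> 0" using be c by simp
  then have x0: "x0 \<ge> 1" "x0 > 0" "e / x0 * c \<le> 1 / 2" by (simp_all add: x0_def divide_le_eq mult.commute)
  define a where "a = CA * norm (f x0)"
  define G0 where "G0 = 2 * (CY * norm (g x0)) + 2 * (e / x0 * (norm A * a))"
  show ?thesis
  proof (rule that[OF x0(2)])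
    fix x assume x: "x \<ge> x0"
    \<comment> \<open>Compactness makes the maximum G of |g| finite, which is needed before G/2 can
      be absorbed on the left. The resulting bound G0 does not depend on x.\<close>
    have "\<exists>y\<in>{x0..x}. \<forall>s\<in>{x0..x}. norm (g s) \<le> norm (g y)"
      using x by (intro continuous_attains_sup continuous_on_norm cont x0) auto
    then obtain y where y: "y \<in> {x0..x}" "\<And>s. s \<in> {x0..x} \<Longrightarrow> norm (g s) \<le> norm (g y)" by blast
    define G where "G = norm (g y)"
    have F: "norm (f s) \<le> a + b * G" if "s \<in> {x0..x}" for s
      unfolding a_def G_def using that by (intro f_bound x0 y) auto
    have H: "norm (g s - A ** f s) \<le> c * G + norm A * a" if s: "s \<in> {x0..x}" for s
    proof -
      have "norm (g s - A ** f s) \<le> norm (g s) + norm A * norm (f s)"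
        by (rule order.trans[OF norm_triangle_ineq4]) (simp add: norm_matrix_mult_le)
      also have "\<dots> \<le> G + norm A * (a + b * G)"
        unfolding G_def[symmetric] using y(2)[OF s] F[OF s]
        by (intro add_mono mult_left_mono) (auto simp: G_def)
      finally show ?thesis by (simp add: c_def algebra_simps)
    qed
    have "G \<le> CY * norm (g x0) + e / x0 * (c * G + norm A * a)"
      unfolding G_def using y(1)
      by (intro g_bound x0) (auto intro: H[unfolded G_def])
    also have "\<dots> = CY * norm (g x0) + (e / x0 * c) * G + e / x0 * (norm A * a)"
      by (simp add: algebra_simps)
    also have "\<dots> \<le> CY * norm (g x0) + (1 / 2) * G + e / x0 * (norm A * a)"
      using x0(3) by (intro add_mono mult_right_mono order.refl) (auto simp: G_def)
    finally have "G \<le> G0" by (simp add: G0_def)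
    then have "b * G \<le> b * G0" using be by (intro mult_left_mono) auto
    then show "norm (f x) \<le> a + b * G0" using F[of x] x by simp
  qed
qed

text \<open>Kummer's system with Z = -Y gives a bound beyond some x0, and continuity gives one on
  the compact rest. The arguments -Y/(t(1-t)) of the beta kernel lie on this half line.\<close>

lemma matrix_1F1_bounded:
  fixes A B Y :: "complex^'n^'n"
  assumes A: "positive_stable A" and B: "positive_stable B" and Y: "positive_stable Y"
    and AB: "commutes A B" and AY: "commutes A Y" and BY: "commutes B Y"
  obtains M where "\<And>x. x \<ge> 0 \<Longrightarrow> norm (matrix_1F1 A B ((- x) *\<^sub>R Y)) \<le> M"
proof -
  define f where "f x = matrix_1F1 A B (x *\<^sub>R (- Y))" for x
  have neg: "commutes A (- Y)" "commutes B (- Y)"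
    using AY BY by (simp_all add: commutes_def mm.minus_left mm.minus_right)
  obtain g where g: "\<And>x. x > 0 \<Longrightarrow> (f has_vector_derivative (1 / x) *\<^sub>R (g x - A ** f x)) (at x)"
    "\<And>x. x > 0 \<Longrightarrow> (g has_vector_derivative
        (1 / x) *\<^sub>R ((mat 1 + A - B) ** (g x - A ** f x)) + (- Y) ** g x) (at x)"
    unfolding f_def using kummer_system[OF B AB neg] by blast
  have g2: "(g has_vector_derivative
        (1 / x) *\<^sub>R ((mat 1 + A - B) ** (g x - A ** f x)) - Y ** g x) (at x)" if "x > 0" for x
    using g(2)[OF that] by (simp add: mm.minus_left)
  obtain M x0 where x0: "x0 > 0" "\<And>x. x \<ge> x0 \<Longrightarrow> norm (f x) \<le> M"
    by (rule bounded_of_kummer_system[OF A Y g(1) g2]) blast+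
  have "continuous_on {0..x0} f"
    unfolding f_def by (rule continuous_on_subset[OF continuous_on_1F1[OF B AB]]) simp
  then have "bounded (f ` {0..x0})"
    by (intro compact_imp_bounded compact_continuous_image) auto
  then obtain N where N: "\<And>x. x \<in> {0..x0} \<Longrightarrow> norm (f x) \<le> N"
    unfolding bounded_iff by blast
  have "norm (f x) \<le> max M N" if "x \<ge> 0" for x
    using x0(2)[of x] N[of x] that by (cases "x \<le> x0") auto
  then show ?thesis using that[of "max M N"] by (simp add: f_def)
qed

subsection \<open>Matrix powers and the gamma and beta matrix functions\<close>

lemma real_powr_matrix_shift:
  assumes "t > 0"
  shows "real_powr_matrix t (P + mat (of_real c)) = t powr c *\<^sub>R real_powr_matrix t (P :: complex^'n^'n)"
proof -
  have "ln t *\<^sub>R (P + mat (of_real c)) = ln t *\<^sub>R P + mat (of_real (c * ln t))"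
    unfolding mat_of_real by (simp add: scaleR_add_right mult.commute)
  then have "real_powr_matrix t (P + mat (of_real c)) = mat (of_real (exp (c * ln t))) ** real_powr_matrix t P"
    unfolding real_powr_matrix_def by (simp only: matrix_exp_shift exp_of_real)
  then show ?thesis using assms unfolding mat_of_real_mult by (simp add: powr_def)
qed

lemma real_powr_matrix_eigenvector:
  assumes "t > 0" "P *v v = l *s v"
  shows "real_powr_matrix t P *v v = (of_real t powr l) *s v"
proof -
  have "(ln t *\<^sub>R P) *v v = (of_real (ln t) * l) *s v"
    unfolding mv.scaleR_left assms(2)
    by (simp add: vec_eq_iff scaleR_conv_of_real[where 'a = complex])
  then have "real_powr_matrix t P *v v = exp (of_real (ln t) * l) *s v"
    unfolding real_powr_matrix_def by (rule matrix_exp_eigenvector)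
  then show ?thesis using assms(1) by (simp add: powr_def Ln_of_real mult.commute)
qed

lemma commutes_real_powr: "commutes X P \<Longrightarrow> commutes X (real_powr_matrix t P)"
  unfolding real_powr_matrix_def by (intro commutes_exp commutes_scaleR)

lemma continuous_on_real_powr_matrix: "continuous_on {0<..} (\<lambda>t. real_powr_matrix t P)"
proof -
  have "continuous_on UNIV (\<lambda>x. matrix_exp (x *\<^sub>R P))"
    by (intro continuous_at_imp_continuous_on ballI)
      (rule has_vector_derivative_continuous[OF matrix_exp_has_vector_derivative])
  then show ?thesis
    unfolding real_powr_matrix_def by (rule continuous_on_compose2) (auto intro!: continuous_intros)
qed

text \<open>With t = exp(-x), the exponential decay of exp(-xP) becomes a positive power of t; after
  the shift by I the singularity at 0 is still integrable.\<close>

lemma real_powr_matrix_bound_at_0: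
  fixes P :: "complex^'n^'n"
  assumes "positive_stable P"
  obtains C d where "C \<ge> 0" "d > 0"
    "\<And>t. 0 < t \<Longrightarrow> t \<le> 1 \<Longrightarrow> norm (real_powr_matrix t (P - mat 1)) \<le> C * t powr (d - 1)"
proof -
  obtain C d where C: "C \<ge> 0" "d > 0"
    "\<And>x. x \<ge> 0 \<Longrightarrow> norm (matrix_exp ((- x) *\<^sub>R P)) \<le> C * exp (- d * x)"
    using matrix_exp_decay[OF assms] by blast
  show ?thesis
  proof (rule that[OF C(1,2)])
    fix t :: real assume t: "0 < t" "t \<le> 1"
    have "real_powr_matrix t (P - mat 1) = t powr (- 1) *\<^sub>R real_powr_matrix t P"
    proof -
      have "P + mat (of_real (- 1)) = P - mat 1" by (simp add: vec_eq_iff mat_def)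
      then show ?thesis using real_powr_matrix_shift[OF t(1), of P "- 1"] by simp
    qed
    then have "norm (real_powr_matrix t (P - mat 1)) = t powr (- 1) * norm (matrix_exp ((- (- ln t)) *\<^sub>R P))"
      by (simp add: real_powr_matrix_def)
    also have "\<dots> \<le> t powr (- 1) * (C * exp (- d * (- ln t)))"
      using t by (intro mult_left_mono C) auto
    also have "\<dots> = C * t powr (d - 1)"
      using t by (simp add: powr_def exp_minus exp_diff left_diff_distrib divide_inverse)
    finally show "norm (real_powr_matrix t (P - mat 1)) \<le> C * t powr (d - 1)" .
  qed
qed

text \<open>A spectral shift: if r exceeds the moduli of all eigenvalues, Q = r - P is positive
  stable, and t^P = t^r t^(-Q) with t^(-Q) bounded for t \<ge> 1. The exponent is written as N - 1
  with N > 0 to match a scalar gamma integrand.\<close>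

lemma real_powr_matrix_bound_at_top:
  fixes P :: "complex^'n^'n"
  obtains C N where "C \<ge> 0" "N > 0"
    "\<And>t. 1 \<le> t \<Longrightarrow> norm (real_powr_matrix t P) \<le> C * t powr (N - 1)"
proof -
  obtain K where K: "K > 0" "\<And>v. norm (P *v v) \<le> norm P * norm v * K"
    using mv.pos_bounded by metis
  \<comment> \<open>\<open>norm P * K\<close> bounds the modulus of every eigenvalue of P; the added
    1 makes the real parts for Q strictly positive.\<close>
  define r where "r = norm P * K + 1"
  define Q where "Q = mat (of_real r) - P"
  have "norm l \<le> norm P * K" if l: "matrix_eigenvalue P l" for l
  proof -
    obtain v where "v \<noteq> 0" "P *v v = l *s v" using l by (auto simp: matrix_eigenvalue_def)
    then show ?thesis using K(2)[of v] by (simp add: norm_vector_smult mult_ac)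
  qed
  moreover have "matrix_eigenvalue P (of_real r - l)" if l: "matrix_eigenvalue Q l" for l
  proof -
    obtain v where v: "v \<noteq> 0" "Q *v v = l *s v" using l by (auto simp: matrix_eigenvalue_def)
    then have "P *v v = (of_real r - l) *s v"
      by (simp add: Q_def matrix_vector_mult_diff_rdistrib mat_vector_mult vec_eq_iff algebra_simps)
    with v show ?thesis by (auto simp: matrix_eigenvalue_def)
  qed
  ultimately have Re: "Re (of_real r - l) \<le> norm P * K" if "matrix_eigenvalue Q l" for l
    using that complex_Re_le_cmod order.trans by blast
  have "0 < Re l" if "matrix_eigenvalue Q l" for l
    using Re[OF that] by (simp add: r_def)
  then have "positive_stable Q" by (simp add: positive_stable_def)
  then obtain C d where C: "C \<ge> 0" "d > 0"
    "\<And>x. x \<ge> 0 \<Longrightarrow> norm (matrix_exp ((- x) *\<^sub>R Q)) \<le> C * exp (- d * x)"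
    using matrix_exp_decay by blast
  show ?thesis
  proof (rule that[of C "r + 1"])
    have "norm P * K \<ge> 0" using K(1) by simp
    then show "r + 1 > 0" unfolding r_def by linarith
    fix t :: real assume t: "1 \<le> t"
    have "P = - Q + mat (of_real r)" by (simp add: Q_def)
    then have "norm (real_powr_matrix t P) = t powr r * norm (matrix_exp ((- ln t) *\<^sub>R Q))"
      using t real_powr_matrix_shift[of t "- Q" r] by (simp add: real_powr_matrix_def)
    also have "\<dots> \<le> t powr r * (C * exp (- d * ln t))" using t by (intro mult_left_mono C) auto
    also have "\<dots> \<le> t powr r * (C * 1)"
      using t C by (intro mult_left_mono) auto
    finally show "norm (real_powr_matrix t P) \<le> C * t powr (r + 1 - 1)" by (simp add: mult.commute)
  qed fact
qed

lemma set_integrable_continuous_bound: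
  fixes f :: "real \<Rightarrow> 'a::euclidean_space" and h :: "real \<Rightarrow> real"
  assumes "set_integrable lborel S h" "S \<in> sets borel" "continuous_on S f"
    and "\<And>t. t \<in> S \<Longrightarrow> norm (f t) \<le> h t"
  shows "set_integrable lborel S f"
proof (rule set_integrable_bound[OF assms(1)])
  show "set_borel_measurable lborel S f"
    unfolding set_borel_measurable_def
    using borel_measurable_continuous_on_indicator[OF assms(2,3)] by simp
  show "AE t in lborel. t \<in> S \<longrightarrow> norm (f t) \<le> norm (h t)"
    using assms(4) by (intro AE_I2) (metis abs_ge_self order.trans real_norm_def)
qed

section \<open>The gamma integral: convergence, eigenvalues, invertibility\<close>

lemma set_integrable_Gamma_real:
  assumes "x > (0::real)"
  shows "set_integrable lborel {0<..} (\<lambda>t. exp (- t) * t powr (x - 1))"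
proof -
  have "integrable lborel (\<lambda>t. indicator {0..} t * t powr (x - 1) / exp t)"
  proof (rule integrableI_nonneg)
    show "(\<integral>\<^sup>+ t. ennreal (indicator {0..} t * t powr (x - 1) / exp t) \<partial>lborel) < \<infinity>"
      by (simp add: Gamma_conv_nn_integral_real[OF assms, symmetric])
  qed (auto simp: indicator_def)
  \<comment> \<open>The closed and the open half line give the same integrand, because
    \<open>0 powr a\<close> is 0.\<close>
  moreover have "indicator {0..} t * t powr (x - 1) / exp t
      = indicator {0<..} t *\<^sub>R (exp (- t) * t powr (x - 1))" for t :: real
    by (auto simp: indicator_def exp_minus field_simps)
  ultimately show ?thesis by (simp add: set_integrable_def)
qed

lemma matrix_Gamma_integrable:
  fixes P :: "complex^'n^'n"
  assumes "positive_stable P"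
  shows "set_integrable lborel {0<..} (\<lambda>t. exp (- t) *\<^sub>R real_powr_matrix t (P - mat 1))"
proof -
  obtain C d where C: "C \<ge> 0" "d > 0"
    "\<And>t. 0 < t \<Longrightarrow> t \<le> 1 \<Longrightarrow> norm (real_powr_matrix t (P - mat 1)) \<le> C * t powr (d - 1)"
    using real_powr_matrix_bound_at_0[OF assms] by blast
  obtain C' N where C': "C' \<ge> 0" "N > 0"
    "\<And>t. 1 \<le> t \<Longrightarrow> norm (real_powr_matrix t (P - mat 1)) \<le> C' * t powr (N - 1)"
    using real_powr_matrix_bound_at_top[of "P - mat 1"] by blast
  show ?thesis
  proof (rule set_integrable_continuous_bound)
    show "set_integrable lborel {0<..} (\<lambda>t. C * (exp (- t) * t powr (d - 1)) + C' * (exp (- t) * t powr (N - 1)))"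
      by (intro set_integral_add set_integrable_mult_right set_integrable_Gamma_real C C')
    show "continuous_on {0<..} (\<lambda>t. exp (- t) *\<^sub>R real_powr_matrix t (P - mat 1))"
      by (intro continuous_intros continuous_on_real_powr_matrix)
    fix t :: real assume t: "t \<in> {0<..}"
    have "C * t powr (d - 1) \<ge> 0" "C' * t powr (N - 1) \<ge> 0" using C C' by auto
    then have "norm (real_powr_matrix t (P - mat 1)) \<le> C * t powr (d - 1) + C' * t powr (N - 1)"
      using C(3)[of t] C'(3)[of t] t by (cases "t \<le> 1") auto
    then have "exp (- t) * norm (real_powr_matrix t (P - mat 1))
        \<le> exp (- t) * (C * t powr (d - 1) + C' * t powr (N - 1))" by simp
    then show "norm (exp (- t) *\<^sub>R real_powr_matrix t (P - mat 1))
        \<le> C * (exp (- t) * t powr (d - 1)) + C' * (exp (- t) * t powr (N - 1))"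
      by (simp add: algebra_simps)
  qed simp
qed

lemma Gamma_set_lebesgue_integral:
  assumes "Re l > 0"
  shows "(LBINT t:{0<..}. exp (- t) *\<^sub>R (of_real t powr (l - 1))) = Gamma l"
proof -
  have int: "set_integrable lborel {0<..} (\<lambda>t. exp (- t) *\<^sub>R (complex_of_real t powr (l - 1)))"
  proof (rule set_integrable_continuous_bound[OF set_integrable_Gamma_real[OF assms]])
    show "continuous_on {0<..} (\<lambda>t. exp (- t) *\<^sub>R (complex_of_real t powr (l - 1)))"
      by (intro continuous_intros) auto
    show "norm (exp (- t) *\<^sub>R (complex_of_real t powr (l - 1))) \<le> exp (- t) * t powr (Re l - 1)"
      if "t \<in> {0<..}" for t using that by (simp add: norm_powr_real_powr)
  qed simp
  have "((\<lambda>t. exp (- t) *\<^sub>R (complex_of_real t powr (l - 1))) has_integral Gamma l) {0<..}"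
    using Gamma_integral_complex'[OF assms]
    by (simp add: scaleR_conv_of_real exp_minus divide_inverse mult.commute exp_of_real)
  then show ?thesis
    using set_borel_integral_eq_integral(2)[OF int] by (simp add: integral_unique)
qed

lemma matrix_Gamma_eigenvector:
  fixes P :: "complex^'n^'n"
  assumes P: "positive_stable P" and v: "P *v v = l *s v" "Re l > 0"
  shows "matrix_Gamma P *v v = Gamma l *s v"
proof -
  let ?h = "\<lambda>t. indicator {0<..} t *\<^sub>R (exp (- t) *\<^sub>R real_powr_matrix t (P - mat 1))"
  let ?c = "\<lambda>t::real. indicator {0<..} t *\<^sub>R (exp (- t) *\<^sub>R (complex_of_real t powr (l - 1)))"
  have int: "integrable lborel ?h"
    using matrix_Gamma_integrable[OF P] by (simp add: set_integrable_def)
  have eig: "(P - mat 1) *v v = (l - 1) *s v"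
    by (simp add: matrix_vector_mult_diff_rdistrib mat_vector_mult v(1) vector_sub_rdistrib)
  have pt: "?h t *v v = ?c t *s v" for t
    using real_powr_matrix_eigenvector[OF _ eig, of t]
    by (auto simp: indicator_def mv.scaleR_left vec_eq_iff)
  have "matrix_Gamma P *v v = (\<integral>t. ?h t *v v \<partial>lborel)"
    unfolding matrix_Gamma_def set_lebesgue_integral_def
    by (rule integral_bounded_linear[OF mv.bounded_linear_left int, symmetric])
  also have "\<dots> = (\<integral>t. ?c t *s v \<partial>lborel)" unfolding pt ..
  also have "\<dots> = (\<integral>t. ?c t \<partial>lborel) *s v"
  proof (rule integral_bounded_linear[OF bounded_linear_smult_left])
    \<comment> \<open>A function that is not integrable has integral 0 by convention, whereas Gamma
      l is nonzero; so the value of the integral already proves integrability.\<close>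
    have "(LBINT t:{0<..}. exp (- t) *\<^sub>R (complex_of_real t powr (l - 1))) \<noteq> 0"
      unfolding Gamma_set_lebesgue_integral[OF v(2)] using v(2) by (auto simp: Gamma_eq_zero_iff elim!: nonpos_Ints_cases)
    then show "integrable lborel ?c"
      unfolding set_lebesgue_integral_def using not_integrable_integral_eq by blast
  qed
  also have "(\<integral>t. ?c t \<partial>lborel) = Gamma l"
    using Gamma_set_lebesgue_integral[OF v(2)] by (simp add: set_lebesgue_integral_def)
  finally show ?thesis .
qed

lemma commutes_Gamma: "commutes X P \<Longrightarrow> commutes X (matrix_Gamma P)"
  unfolding matrix_Gamma_def
  by (intro commutes_integral commutes_scaleR commutes_real_powr commutes_diff commutes_mat)

text \<open>Gamma(P) commutes with P, so P - l maps the kernel of Gamma(P) into itself. By induction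
  a kernel vector is an eigenvector of P, on which Gamma(P) acts as the scalar Gamma(l); this has no
  zeros.\<close>

lemma matrix_Gamma_invertible:
  fixes P :: "complex^'n^'n"
  assumes P: "positive_stable P"
  shows "invertible (matrix_Gamma P)"
  unfolding invertible_iff_ker
proof
  fix v
  show "matrix_Gamma P *v v = 0 \<longrightarrow> v = 0"
  proof (induction v rule: eigen_induct[of _ P])
    case (step v l)
    show ?case
    proof
      assume v: "matrix_Gamma P *v v = 0"
      have "matrix_Gamma P ** P = P ** matrix_Gamma P"
        using commutes_Gamma[OF commutes_refl, of P] by (simp add: commutes_def)
      then have "matrix_Gamma P *v (P *v v) = P *v (matrix_Gamma P *v v)"
        by (simp add: matrix_vector_mul_assoc)
      then have "matrix_Gamma P *v (P *v v - l *s v) = 0"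
        by (simp add: matrix_vector_mult_diff_distrib vector_scalar_commute v)
      then have Pv: "P *v v = l *s v" using step.IH by simp
      have l: "Re l > 0" using P step.hyps by (auto simp: positive_stable_def)
      then have "Gamma l \<noteq> 0" by (auto simp: Gamma_eq_zero_iff elim!: nonpos_Ints_cases)
      moreover have "Gamma l *s v = 0" using matrix_Gamma_eigenvector[OF P Pv l] v by simp
      ultimately show "v = 0" by simp
    qed
  qed simp
qed

lemma invertible_matrix_inv: "invertible (M :: complex^'n^'n) \<Longrightarrow> invertible (matrix_inv M)"
  by (metis invertible_def matrix_mult_inv matrix_inv_mult)

lemma matrix_Beta_invertible:
  fixes P Q :: "complex^'n^'n"
  assumes "positive_stable P" "positive_stable Q" "commutes P Q"
  shows "invertible (matrix_Beta P Q)"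
  unfolding matrix_Beta_def using assms
  by (intro invertible_mult invertible_matrix_inv matrix_Gamma_invertible positive_stable_add)
    (simp_all add: commutes_def)

lemma commutes_Beta:
  fixes P Q :: "complex^'n^'n"
  assumes "positive_stable P" "positive_stable Q" "commutes P Q" "commutes X P" "commutes X Q"
  shows "commutes X (matrix_Beta P Q)"
  unfolding matrix_Beta_def using assms
  by (intro commutes_mult commutes_inv commutes_Gamma commutes_add matrix_Gamma_invertible
      positive_stable_add) (simp_all add: commutes_def)

subsection \<open>Convergence of the extended Appell function\<close>

text \<open>Ratio test: consecutive terms have quotient at most |z| (|B| + m) / (m + 1), which tends
  to |z| < 1.\<close>

lemma pochhammer_power_series_summable:
  fixes B :: "complex^'n^'n" and z :: complex
  assumes z: "norm z < 1"
  shows "summable (\<lambda>m. norm (z ^ m / fact m) * norm (matrix_pochhammer B m))"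
proof -
  define u where "u m = norm (z ^ m / fact m) * norm (matrix_pochhammer B m)" for m
  \<comment> \<open>\<open>c\<close> lies halfway between |z| and 1, and \<open>N\<close> is an
    index from which |z| (|B| + m) \<le> c m holds.\<close>
  define c where "c = (1 + norm z) / 2"
  have c: "norm z < c" "c < 1" using z by (simp_all add: c_def)
  define N where "N = nat \<lceil>norm z * norm B / (c - norm z)\<rceil>"
  have "summable u"
  proof (rule summable_ratio_test[OF c(2)])
    fix m assume "m \<ge> N"
    then have "norm z * norm B / (c - norm z) \<le> real m" unfolding N_def by linarith
    then have "norm z * norm B \<le> (c - norm z) * real m"
      using c by (simp add: divide_le_eq mult.commute)
    then have ratio: "norm z * (norm B + real m) \<le> c * real (Suc m)"
      using c order.trans[OF norm_ge_zero less_imp_le[OF c(1)]] by (simp add: algebra_simps)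
    have "matrix_pochhammer B m ** mat (of_nat m) = real m *\<^sub>R matrix_pochhammer B m"
      using mat_of_real_mult[of "real m" "matrix_pochhammer B m"] by (simp add: mat_mult_commute)
    then have "norm (matrix_pochhammer B (Suc m)) \<le> norm (matrix_pochhammer B m ** B) + real m * norm (matrix_pochhammer B m)"
      by (simp add: mm.add_right) (metis abs_of_nat norm_scaleR norm_triangle_ineq)
    also have "\<dots> \<le> norm (matrix_pochhammer B m) * (norm B + real m)"
      using norm_matrix_mult_le[of "matrix_pochhammer B m" B] by (simp add: algebra_simps)
    finally have "u (Suc m) \<le> norm (z ^ Suc m / fact (Suc m)) * (norm (matrix_pochhammer B m) * (norm B + real m))"
      unfolding u_def by (intro mult_left_mono) auto
    also have "\<dots> = u m * (norm z * (norm B + real m) / real (Suc m))"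
      by (simp add: u_def norm_mult norm_divide norm_power field_simps del: of_nat_Suc)
    also have "\<dots> \<le> u m * c"
      using ratio by (intro mult_left_mono) (auto simp: divide_le_eq u_def simp del: of_nat_Suc)
    finally show "norm (u (Suc m)) \<le> c * norm (u m)" by (simp add: u_def mult.commute)
  qed
  then show ?thesis by (simp add: u_def[abs_def])
qed

lemma has_sum_diff:
  fixes f g :: "'a \<Rightarrow> 'b::real_normed_vector"
  assumes "(f has_sum a) S" "(g has_sum b) S"
  shows "((\<lambda>x. f x - g x) has_sum (a - b)) S"
  using has_sum_add[OF assms(1) has_sum_bounded_linear[OF bounded_linear_minus[OF bounded_linear_ident] assms(2)]]
  by simp

lemma product_summable_on:
  fixes u v :: "nat \<Rightarrow> real"
  assumes "summable u" "summable v" "\<And>m. u m \<ge> 0" "\<And>n. v n \<ge> 0"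
  shows "(\<lambda>(m, n). u m * v n) summable_on UNIV"
proof -
  have u: "u summable_on UNIV" and v: "v summable_on UNIV"
    using assms by (auto intro!: norm_summable_imp_summable_on)
  have "(\<lambda>p. norm (case p of (m, n) \<Rightarrow> u m * v n)) summable_on (Sigma UNIV (\<lambda>_. UNIV))"
    unfolding Infinite_Sum.abs_summable_on_Sigma_iff
    using assms(3,4) by (auto simp: abs_mult infsum_cmult_right' infsum_nonneg
        intro!: summable_on_cmult_right summable_on_cmult_left u v)
  then show ?thesis using abs_summable_summable by fastforce
qed

text \<open>Near the endpoints the argument of 1F1 is unbounded but its value is not, so the two
  powers leave a scalar beta integrand. The extra factor t^k is at most 1 on (0,1); hence one
  majorant \<open>h\<close> serves all k, and its integral bounds all beta coefficients of the
  Appell series.\<close>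

lemma extended_Beta_integrable:
  fixes A B Y P Q :: "complex^'n^'n"
  assumes A: "positive_stable A" and B: "positive_stable B" and Y: "positive_stable Y"
    and AB: "commutes A B" and AY: "commutes A Y" and BY: "commutes B Y"
    and P: "positive_stable P" and Q: "positive_stable Q"
  defines "F k t \<equiv> matrix_1F1 A B ((- 1 / (t * (1 - t))) *\<^sub>R Y)
         ** real_powr_matrix t (P + mat (of_nat k) - mat 1) ** real_powr_matrix (1 - t) (Q - mat 1)"
  shows "set_integrable lborel {0<..<1} (F k)"
    and "\<exists>M. \<forall>k. norm (extended_Beta A B Y (P + mat (of_nat k)) Q) \<le> M"
proof -
  obtain M where M: "\<And>x. x \<ge> 0 \<Longrightarrow> norm (matrix_1F1 A B ((- x) *\<^sub>R Y)) \<le> M"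
    using matrix_1F1_bounded[OF A B Y AB AY BY] by blast
  have M0: "M \<ge> 0" using order.trans[OF norm_ge_zero M[of 0]] by simp
  obtain C d where C: "C \<ge> 0" "d > 0"
    "\<And>t. 0 < t \<Longrightarrow> t \<le> 1 \<Longrightarrow> norm (real_powr_matrix t (P - mat 1)) \<le> C * t powr (d - 1)"
    using real_powr_matrix_bound_at_0[OF P] by blast
  obtain C' d' where C': "C' \<ge> 0" "d' > 0"
    "\<And>t. 0 < t \<Longrightarrow> t \<le> 1 \<Longrightarrow> norm (real_powr_matrix t (Q - mat 1)) \<le> C' * t powr (d' - 1)"
    using real_powr_matrix_bound_at_0[OF Q] by blast
  define h where "h t = (M * C * C') * (t powr (d - 1) * (1 - t) powr (d' - 1))" for t :: real
  have "set_integrable lborel {0<..<1} (\<lambda>t. t powr (d - 1) * (1 - t) powr (d' - 1))"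
    by (rule set_integrable_subset[OF integrable_Beta]) (use C C' in auto)
  then have h_int: "set_integrable lborel {0<..<1} h"
    unfolding h_def by (rule set_integrable_mult_right)
  have bound: "norm (F k t) \<le> h t" if t: "t \<in> {0<..<1}" for k t
  proof -
    have shift: "P + mat (of_nat k) - mat 1 = (P - mat 1) + mat (of_real (real k))" by simp
    have "norm (real_powr_matrix t (P + mat (of_nat k) - mat 1))
        = t powr real k * norm (real_powr_matrix t (P - mat 1))"
      unfolding shift using t by (subst real_powr_matrix_shift) auto
    also have "\<dots> \<le> 1 * norm (real_powr_matrix t (P - mat 1))"
      using t by (intro mult_right_mono) (auto intro: powr_le1)
    also have "\<dots> \<le> C * t powr (d - 1)" using t C(3) by simp
    finally have p: "norm (real_powr_matrix t (P + mat (of_nat k) - mat 1)) \<le> C * t powr (d - 1)" .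
    have q: "norm (real_powr_matrix (1 - t) (Q - mat 1)) \<le> C' * (1 - t) powr (d' - 1)"
      using t by (intro C') auto
    have "norm (matrix_1F1 A B ((- 1 / (t * (1 - t))) *\<^sub>R Y)) \<le> M"
      using M[of "1 / (t * (1 - t))"] t by simp
    then have "norm (F k t) \<le> (M * (C * t powr (d - 1))) * (C' * (1 - t) powr (d' - 1))"
      unfolding F_def using M0 C(1)
      by (intro order.trans[OF norm_matrix_mult_le] mult_mono p q) auto
    then show ?thesis by (simp add: h_def mult_ac)
  qed
  have int: "set_integrable lborel {0<..<1} (F k)" for k
  proof (rule set_integrable_continuous_bound[OF h_int _ _ bound])
    have "continuous_on {0<..<1} (\<lambda>t. matrix_1F1 A B ((- 1 / (t * (1 - t))) *\<^sub>R Y))"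
      by (rule continuous_on_compose2[OF continuous_on_1F1[OF B AB]]) (auto intro!: continuous_intros)
    moreover have "continuous_on {0<..<1} (\<lambda>t. real_powr_matrix t (P + mat (of_nat k) - mat 1))"
      by (rule continuous_on_subset[OF continuous_on_real_powr_matrix]) auto
    moreover have "continuous_on {0<..<1} (\<lambda>t. real_powr_matrix (1 - t) (Q - mat 1))"
      by (rule continuous_on_compose2[OF continuous_on_real_powr_matrix]) (auto intro!: continuous_intros)
    ultimately show "continuous_on {0<..<1} (F k)"
      unfolding F_def by (intro mm.continuous_on)
  qed auto
  show "set_integrable lborel {0<..<1} (F k)" by (rule int)
  have "norm (extended_Beta A B Y (P + mat (of_nat k)) Q) \<le> (LBINT t:{0<..<1}. h t)" for k
    unfolding extended_Beta_def F_def[symmetric] set_lebesgue_integral_def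
  proof (rule Bochner_Integration.integral_norm_bound_integral)
    show "integrable lborel (\<lambda>t. indicator {0<..<1} t *\<^sub>R F k t)"
      using int[of k] by (simp add: set_integrable_def)
    show "integrable lborel (\<lambda>t. indicator {0<..<1} t *\<^sub>R h t)"
      using h_int by (simp add: set_integrable_def)
  qed (use bound in \<open>auto simp: indicator_def\<close>)
  then show "\<exists>M. \<forall>k. norm (extended_Beta A B Y (P + mat (of_nat k)) Q) \<le> M" by blast
qed

lemma extended_Beta_integrable0:
  fixes A B Y P Q :: "complex^'n^'n"
  assumes "positive_stable A" "positive_stable B" "positive_stable Y"
    "commutes A B" "commutes A Y" "commutes B Y" "positive_stable P" "positive_stable Q"
  shows "set_integrable lborel {0<..<1} (\<lambda>t. matrix_1F1 A B ((- 1 / (t * (1 - t))) *\<^sub>R Y)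
         ** real_powr_matrix t (P - mat 1) ** real_powr_matrix (1 - t) (Q - mat 1))"
  using extended_Beta_integrable(1)[OF assms, of 0] by simp

lemma commutes_extended_Beta:
  assumes "positive_stable B" "commutes A B" "commutes X A" "commutes X B" "commutes X Y"
    "commutes X P" "commutes X Q"
  shows "commutes X (extended_Beta A B Y P Q)"
  unfolding extended_Beta_def
  by (intro commutes_integral commutes_mult commutes_1F1 commutes_real_powr commutes_diff
      commutes_scaleR commutes_mat assms)

definition appell_term where
  "appell_term A B A1 B1 B2 C1 z w Y = (\<lambda>(m, n).
     mat (z ^ m * w ^ n / (fact m * fact n)) **
     (extended_Beta A B Y (A1 + mat (of_nat (m + n))) (C1 - A1)
        ** matrix_inv (matrix_Beta A1 (C1 - A1)) ** matrix_pochhammer B1 m ** matrix_pochhammer B2 n))"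

text \<open>The beta coefficients are bounded uniformly in m + n; what remains is dominated by a
  product of two convergent series. An unordered sum that does not converge is 0 by convention, so
  relations between summands pass to the sums only with this knowledge.\<close>

lemma extended_Appell_F1_has_sum:
  fixes A B A1 B1 B2 C1 Y :: "complex^'n^'n"
  assumes "positive_stable A" "positive_stable B" "positive_stable Y"
    "commutes A B" "commutes A Y" "commutes B Y" "positive_stable A1" "positive_stable (C1 - A1)"
    and z: "norm z < 1" and w: "norm w < 1"
  shows "(appell_term A B A1 B1 B2 C1 z w Y has_sum extended_Appell_F1 A B A1 B1 B2 C1 z w Y) UNIV"
proof -
  obtain M where M: "\<And>k. norm (extended_Beta A B Y (A1 + mat (of_nat k)) (C1 - A1)) \<le> M"
    using extended_Beta_integrable(2)[OF assms(1-8)] by blast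
  define b where "b = norm (matrix_inv (matrix_Beta A1 (C1 - A1)))"
  define u where "u m = norm (z ^ m / fact m) * norm (matrix_pochhammer B1 m)" for m
  define v where "v n = norm (w ^ n / fact n) * norm (matrix_pochhammer B2 n)" for n
  have "(\<lambda>(m, n). u m * v n) summable_on UNIV"
    by (rule product_summable_on)
      (auto simp: u_def v_def pochhammer_power_series_summable[OF z] pochhammer_power_series_summable[OF w])
  then have "(\<lambda>p. (M * b) * (\<lambda>(m, n). u m * v n) p) summable_on UNIV"
    by (rule summable_on_cmult_right)
  moreover have "norm (appell_term A B A1 B1 B2 C1 z w Y p) \<le> (M * b) * (\<lambda>(m, n). u m * v n) p" for p
  proof -
    obtain m n where p: "p = (m, n)" by (cases p)
    let ?E = "extended_Beta A B Y (A1 + mat (of_nat (m + n))) (C1 - A1)"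
    have M0: "M \<ge> 0" using order.trans[OF norm_ge_zero M] .
    have "norm (?E ** matrix_inv (matrix_Beta A1 (C1 - A1)) ** matrix_pochhammer B1 m ** matrix_pochhammer B2 n)
      \<le> M * b * norm (matrix_pochhammer B1 m) * norm (matrix_pochhammer B2 n)"
      using M0 unfolding b_def
      by (intro order.trans[OF norm_matrix_mult_le] mult_right_mono M) auto
    then have "norm (z ^ m * w ^ n / (fact m * fact n)) *
        norm (?E ** matrix_inv (matrix_Beta A1 (C1 - A1)) ** matrix_pochhammer B1 m ** matrix_pochhammer B2 n)
      \<le> norm (z ^ m * w ^ n / (fact m * fact n)) *
        (M * b * norm (matrix_pochhammer B1 m) * norm (matrix_pochhammer B2 n))"
      by (rule mult_left_mono) simp
    also have "\<dots> = (M * b) * (u m * v n)"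
      by (simp add: u_def v_def norm_mult norm_divide)
    finally show ?thesis by (simp add: p appell_term_def norm_mat_mult)
  qed
  ultimately have "(\<lambda>p. norm (appell_term A B A1 B1 B2 C1 z w Y p)) summable_on UNIV"
    by (rule Infinite_Sum.abs_summable_on_comparison_test')
  then have "appell_term A B A1 B1 B2 C1 z w Y summable_on UNIV"
    by (rule abs_summable_summable)
  then show ?thesis
    unfolding extended_Appell_F1_def appell_term_def by (rule has_sum_infsum)
qed

subsection \<open>Contiguous relations\<close>

text \<open>The recursion appends factors on the right; peeling off the first factor instead links
  the parameters M and M + I.\<close>

lemma matrix_pochhammer_Suc_left:
  "matrix_pochhammer M (Suc n) = M ** matrix_pochhammer (M + mat 1) n"
proof (induction n)
  case (Suc n)
  have "M + mat (of_nat (Suc n)) = (M + mat 1) + mat (of_nat n)"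
    by (simp add: mat_add add.assoc)
  then have "matrix_pochhammer M (Suc (Suc n))
      = matrix_pochhammer M (Suc n) ** ((M + mat 1) + mat (of_nat n))"
    by (simp only: matrix_pochhammer.simps(2))
  then show ?case unfolding Suc.IH by (simp add: matrix_mul_assoc)
qed simp

text \<open>All three terms become multiples of one quotient: (B - I) [(B-I)_n]^(-1) = (B - I + n)
  [(B)_n]^(-1) and A (A+I)_n = (A)_n (A + n), and the difference of the new factors is B - (A +
  I).\<close>

lemma hyp_coeff_contiguous_B:
  fixes A B Z :: "complex^'n^'n"
  assumes B: "positive_stable (B - mat 1)" and AB: "commutes A B"
  shows "(B - (A + mat 1)) ** hyp_coeff A B Z n
    = (B - mat 1) ** hyp_coeff A (B - mat 1) Z n - A ** hyp_coeff (A + mat 1) B Z n"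
proof -
  define p q q' s where "p = matrix_pochhammer A n" and "q = matrix_inv (matrix_pochhammer B n)"
    and "q' = matrix_inv (matrix_pochhammer (B - mat 1) n)"
    and "s = (1 / fact n) *\<^sub>R matrix_power Z n"
  have B': "positive_stable B" using positive_stable_add_mat[OF B, of 1] by simp
  note inv = invertible_pochhammer[OF B] invertible_pochhammer[OF B']
  have BA: "commutes B A" by (rule commutes_sym[OF AB])
  have Bp: "(B - mat 1) ** p = p ** (B - mat 1)" and Ap: "A ** p = p ** A" and BAp: "B ** p = p ** B"
    unfolding p_def commutes_def[symmetric]
    by (auto intro!: commutes_pochhammer commutes_diff_left BA)
  have "commutes (B - mat 1) q'"
    unfolding q'_def by (intro commutes_inv commutes_pochhammer inv commutes_refl)
  then have q'_comm: "q' ** (B - mat 1) = (B - mat 1) ** q'" by (simp add: commutes_def)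
  \<comment> \<open>Both sides are (B-I)_(n+1), split off once at the last factor and once at the
    first.\<close>
  have "matrix_pochhammer (B - mat 1) n ** (B - mat 1 + mat (of_nat n)) = (B - mat 1) ** matrix_pochhammer B n"
    using matrix_pochhammer_Suc_left[of "B - mat 1" n] by simp
  then have "q' ** matrix_pochhammer (B - mat 1) n ** (B - mat 1 + mat (of_nat n)) ** q
      = q' ** (B - mat 1) ** (matrix_pochhammer B n ** q)"
    by (simp add: matrix_mul_assoc) (simp flip: matrix_mul_assoc)
  then have q': "(B - mat 1) ** q' = (B - mat 1 + mat (of_nat n)) ** q"
    using q'_comm by (simp add: q_def q'_def matrix_mult_inv matrix_inv_mult inv)
  have p': "A ** matrix_pochhammer (A + mat 1) n = p ** (A + mat (of_nat n))"
    using matrix_pochhammer_Suc_left[of A n] by (simp add: p_def)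
  have "(B - mat 1) ** hyp_coeff A (B - mat 1) Z n = ((B - mat 1) ** p) ** q' ** s"
    by (simp add: hyp_coeff_def p_def q'_def s_def matrix_mul_assoc)
  also have "\<dots> = p ** ((B - mat 1) ** q') ** s" by (simp add: Bp matrix_mul_assoc)
  finally have 1: "(B - mat 1) ** hyp_coeff A (B - mat 1) Z n = p ** (B - mat 1 + mat (of_nat n)) ** q ** s"
    by (simp add: q' matrix_mul_assoc)
  have 2: "A ** hyp_coeff (A + mat 1) B Z n = p ** (A + mat (of_nat n)) ** q ** s"
    by (simp add: hyp_coeff_def q_def s_def matrix_mul_assoc p')
  have "(B - (A + mat 1)) ** p = p ** ((B - mat 1 + mat (of_nat n)) - (A + mat (of_nat n)))"
    by (simp add: mm.diff_left mm.diff_right mm.add_left mm.add_right Ap BAp)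
  then have "(B - (A + mat 1)) ** hyp_coeff A B Z n
      = p ** ((B - mat 1 + mat (of_nat n)) - (A + mat (of_nat n))) ** q ** s"
    by (simp add: hyp_coeff_def p_def q_def s_def matrix_mul_assoc)
  then show ?thesis unfolding 1 2 by (simp only: mm.diff_left mm.diff_right)
qed

text \<open>The Pochhammer symbols differ by (A)_(n+1) - (A-I)_(n+1) = (A)_n ((A + n) - (A - I)) =
  (n + 1) (A)_n. The factor n + 1 turns 1/(n+1)! into 1/n!, and B [(B)_(n+1)]^(-1) =
  [(B+I)_n]^(-1).\<close>

lemma hyp_coeff_contiguous_A:
  fixes A B Z :: "complex^'n^'n"
  assumes B: "positive_stable B" and AB: "commutes A B" and AZ: "commutes A Z" and BZ: "commutes B Z"
  shows "B ** hyp_coeff A B Z (Suc n) - B ** hyp_coeff (A - mat 1) B Z (Suc n)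
    = Z ** hyp_coeff A (B + mat 1) Z n"
proof -
  define p q s where "p = matrix_pochhammer A n" and "q = matrix_inv (matrix_pochhammer (B + mat 1) n)"
    and "s = (1 / fact n) *\<^sub>R matrix_power Z n"
  have B1: "positive_stable (B + mat 1)" by (simp add: positive_stable_add_mat B)
  have inv: "invertible B" "invertible (matrix_pochhammer (B + mat 1) n)"
    by (rule positive_stable_invertible[OF B], rule invertible_pochhammer[OF B1])
  have comm: "commutes X p" if "commutes X A" for X
    unfolding p_def by (intro commutes_pochhammer that)
  have comm_q: "commutes X q" if "commutes X B" for X
    unfolding q_def by (intro commutes_inv commutes_pochhammer commutes_add commutes_mat that inv)
  have ZA: "commutes Z A" and ZB: "commutes Z B" and BA: "commutes B A"
    using AZ BZ AB by (auto intro: commutes_sym)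
  have ps: "matrix_pochhammer A (Suc n) = p ** (A + mat (of_nat n))"
    by (simp add: p_def)
  have ps': "matrix_pochhammer (A - mat 1) (Suc n) = p ** (A - mat 1)"
  proof -
    have "commutes (A - mat 1) p"
      by (intro comm commutes_diff_left) simp_all
    then show ?thesis
      using matrix_pochhammer_Suc_left[of "A - mat 1" n] by (simp add: p_def commutes_def)
  qed
  have "matrix_pochhammer A (Suc n) - matrix_pochhammer (A - mat 1) (Suc n)
      = p ** ((A + mat (of_nat n)) - (A - mat 1))"
    unfolding ps ps' by (simp only: mm.diff_right)
  also have "(A + mat (of_nat n)) - (A - mat 1) = mat (of_real (real (Suc n)))"
    by (simp add: mat_add add.commute)
  finally have diff: "matrix_pochhammer A (Suc n) - matrix_pochhammer (A - mat 1) (Suc n)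
      = real (Suc n) *\<^sub>R p"
    by (simp only: mat_of_real_mult flip: mat_mult_commute)
  have qs: "matrix_inv (matrix_pochhammer B (Suc n)) = q ** matrix_inv B"
    unfolding matrix_pochhammer_Suc_left q_def by (rule matrix_inv_prod[OF inv])
  have "B ** hyp_coeff A B Z (Suc n) - B ** hyp_coeff (A - mat 1) B Z (Suc n)
      = B ** ((matrix_pochhammer A (Suc n) - matrix_pochhammer (A - mat 1) (Suc n))
        ** (q ** matrix_inv B) ** ((1 / fact (Suc n)) *\<^sub>R matrix_power Z (Suc n)))"
    unfolding hyp_coeff_def qs by (simp only: mm.diff_left mm.diff_right)
  also have "\<dots> = B ** p ** q ** matrix_inv B ** (real (Suc n) *\<^sub>R ((1 / fact (Suc n)) *\<^sub>R (Z ** matrix_power Z n)))"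
    unfolding diff
    by (simp only: mm.scaleR_left mm.scaleR_right matrix_mul_assoc matrix_power.simps)
      (rule scaleR_left_commute)
  also have "real (Suc n) *\<^sub>R ((1 / fact (Suc n)) *\<^sub>R (Z ** matrix_power Z n)) = Z ** s"
    unfolding s_def by (simp add: mm.scaleR_right field_simps del: of_nat_Suc)
  also have "B ** p ** q = p ** q ** B"
    using comm[OF BA] comm_q[OF commutes_refl] unfolding commutes_def by (metis matrix_mul_assoc)
  also have "p ** q ** B ** matrix_inv B ** (Z ** s) = p ** q ** (B ** matrix_inv B) ** Z ** s"
    by (simp add: matrix_mul_assoc)
  also have "\<dots> = p ** q ** Z ** s" by (simp add: matrix_mult_inv inv)
  also have "p ** q ** Z = Z ** p ** q"
    using comm[OF ZA] comm_q[OF ZB] unfolding commutes_def by (metis matrix_mul_assoc)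
  finally show ?thesis by (simp add: hyp_coeff_def p_def q_def s_def matrix_mul_assoc)
qed

lemma matrix_1F1_contiguous_B:
  fixes A B Z :: "complex^'n^'n"
  assumes B: "positive_stable (B - mat 1)" and AB: "commutes A B"
  shows "(B - (A + mat 1)) ** matrix_1F1 A B (x *\<^sub>R Z)
    = (B - mat 1) ** matrix_1F1 A (B - mat 1) (x *\<^sub>R Z) - A ** matrix_1F1 (A + mat 1) B (x *\<^sub>R Z)"
proof -
  have B': "positive_stable B" using positive_stable_add_mat[OF B, of 1] by simp
  have AB1: "commutes A (B - mat 1)" "commutes (A + mat 1) B"
    using AB by (auto intro!: commutes_diff commutes_add_left)
  have "(\<lambda>n. (B - mat 1) ** (x ^ n *\<^sub>R hyp_coeff A (B - mat 1) Z n) - A ** (x ^ n *\<^sub>R hyp_coeff (A + mat 1) B Z n))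
    sums ((B - mat 1) ** matrix_1F1 A (B - mat 1) (x *\<^sub>R Z) - A ** matrix_1F1 (A + mat 1) B (x *\<^sub>R Z))"
    by (intro sums_diff bounded_linear.sums[OF mm.bounded_linear_right] matrix_1F1_sums B B' AB1)
  moreover have "(B - mat 1) ** (x ^ n *\<^sub>R hyp_coeff A (B - mat 1) Z n) - A ** (x ^ n *\<^sub>R hyp_coeff (A + mat 1) B Z n)
     = (B - (A + mat 1)) ** (x ^ n *\<^sub>R hyp_coeff A B Z n)" for n
    by (simp only: mm.scaleR_right hyp_coeff_contiguous_B[OF B AB] scaleR_diff_right)
  moreover have "(\<lambda>n. (B - (A + mat 1)) ** (x ^ n *\<^sub>R hyp_coeff A B Z n))
    sums ((B - (A + mat 1)) ** matrix_1F1 A B (x *\<^sub>R Z))"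
    by (intro bounded_linear.sums[OF mm.bounded_linear_right] matrix_1F1_sums B' AB)
  ultimately show ?thesis by (simp add: sums_iff)
qed

text \<open>The constant terms of the two series cancel; the other terms, shifted by one index, have
  the common factor x Z.\<close>

lemma matrix_1F1_contiguous_A:
  fixes A B Z :: "complex^'n^'n"
  assumes B: "positive_stable B" and AB: "commutes A B" and AZ: "commutes A Z" and BZ: "commutes B Z"
  shows "B ** matrix_1F1 A B (x *\<^sub>R Z) - B ** matrix_1F1 (A - mat 1) B (x *\<^sub>R Z)
    = x *\<^sub>R (Z ** matrix_1F1 A (B + mat 1) (x *\<^sub>R Z))"
proof -
  have B1: "positive_stable (B + mat 1)" by (simp add: positive_stable_add_mat B)
  have AB1: "commutes A (B + mat 1)" using AB by (auto intro!: commutes_add)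
  have AB2: "commutes (A - mat 1) B"
    using AB by (auto intro!: commutes_diff_left)
  define a where "a n = B ** (x ^ n *\<^sub>R hyp_coeff A B Z n) - B ** (x ^ n *\<^sub>R hyp_coeff (A - mat 1) B Z n)" for n
  have "a sums (B ** matrix_1F1 A B (x *\<^sub>R Z) - B ** matrix_1F1 (A - mat 1) B (x *\<^sub>R Z))"
    unfolding a_def
    by (intro sums_diff bounded_linear.sums[OF mm.bounded_linear_right] matrix_1F1_sums B AB AB2)
  moreover have "(\<lambda>n. x *\<^sub>R (Z ** (x ^ n *\<^sub>R hyp_coeff A (B + mat 1) Z n)))
      sums (x *\<^sub>R (Z ** matrix_1F1 A (B + mat 1) (x *\<^sub>R Z)))"
    by (intro sums_scaleR_right bounded_linear.sums[OF mm.bounded_linear_right] matrix_1F1_sums B1 AB1)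
  moreover have "x *\<^sub>R (Z ** (x ^ n *\<^sub>R hyp_coeff A (B + mat 1) Z n)) = a (Suc n)" for n
  proof -
    have "a (Suc n) = x ^ Suc n *\<^sub>R (Z ** hyp_coeff A (B + mat 1) Z n)"
      unfolding a_def mm.scaleR_right scaleR_diff_right[symmetric] hyp_coeff_contiguous_A[OF assms] ..
    then show ?thesis by (simp add: mm.scaleR_right)
  qed
  moreover have "a 0 = 0"
    by (simp add: a_def hyp_coeff_def)
  ultimately show ?thesis using sums_Suc[of a] by (simp add: sums_iff)
qed

section \<open>Contiguous relations under the beta integral\<close>

lemma matrix_mult_set_integral:
  fixes X :: "complex^'n^'n" and f :: "real \<Rightarrow> complex^'n^'n"
  assumes "set_integrable lborel S f"
  shows "X ** (LBINT t:S. f t) = (LBINT t:S. X ** f t)" and "set_integrable lborel S (\<lambda>t. X ** f t)"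
proof -
  have int: "integrable lborel (\<lambda>t. indicator S t *\<^sub>R f t)"
    using assms by (simp add: set_integrable_def)
  have scale: "X ** (indicator S t *\<^sub>R f t) = indicator S t *\<^sub>R (X ** f t)" for t
    by (rule mm.scaleR_right)
  show "X ** (LBINT t:S. f t) = (LBINT t:S. X ** f t)"
    unfolding set_lebesgue_integral_def integral_bounded_linear[OF mm.bounded_linear_right int, symmetric] scale ..
  show "set_integrable lborel S (\<lambda>t. X ** f t)"
    using integrable_bounded_linear[OF mm.bounded_linear_right int, of X]
    unfolding set_integrable_def scale .
qed

text \<open>The coefficients of the pointwise relation do not depend on t and stand on the left, so
  they pass in front of the integral without touching the powers of t and 1 - t.\<close>

lemma extended_Beta_contiguous_B:
  fixes A B Y P Q :: "complex^'n^'n"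
  assumes A: "positive_stable A" and B: "positive_stable (B - mat 1)" and Y: "positive_stable Y"
    and AB: "commutes A B" and AY: "commutes A Y" and BY: "commutes B Y"
    and P: "positive_stable P" and Q: "positive_stable Q"
  shows "(B - (A + mat 1)) ** extended_Beta A B Y P Q
    = (B - mat 1) ** extended_Beta A (B - mat 1) Y P Q - A ** extended_Beta (A + mat 1) B Y P Q"
proof -
  define F where "F A' B' t = matrix_1F1 A' B' ((- 1 / (t * (1 - t))) *\<^sub>R Y)
         ** real_powr_matrix t (P - mat 1) ** real_powr_matrix (1 - t) (Q - mat 1)" for A' B' t
  have E: "extended_Beta A' B' Y P Q = (LBINT t:{0<..<1}. F A' B' t)" for A' B'
    by (simp add: extended_Beta_def F_def)
  have B': "positive_stable B" using positive_stable_add_mat[OF B, of 1] by simp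
  have A1: "positive_stable (A + mat 1)" by (simp add: positive_stable_add_mat A)
  have comm: "commutes A (B - mat 1)" "commutes (A + mat 1) B" "commutes (A + mat 1) Y"
    "commutes (B - mat 1) Y"
    using AB AY BY by (auto intro!: commutes_diff commutes_add_left commutes_diff_left)
  have int: "set_integrable lborel {0<..<1} (F A B)" "set_integrable lborel {0<..<1} (F A (B - mat 1))"
    "set_integrable lborel {0<..<1} (F (A + mat 1) B)"
    unfolding F_def
    by (intro extended_Beta_integrable0 A B Y AB AY BY P Q B' A1 comm)+
  have "(B - (A + mat 1)) ** F A B t = (B - mat 1) ** F A (B - mat 1) t - A ** F (A + mat 1) B t" for t
    using arg_cong[OF matrix_1F1_contiguous_B[OF B AB, of "- 1 / (t * (1 - t))" Y],
        of "\<lambda>M. M ** real_powr_matrix t (P - mat 1) ** real_powr_matrix (1 - t) (Q - mat 1)"]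
    unfolding F_def by (simp only: matrix_mul_assoc mm.diff_left)
  then have "(LBINT t:{0<..<1}. (B - (A + mat 1)) ** F A B t)
      = (LBINT t:{0<..<1}. (B - mat 1) ** F A (B - mat 1) t - A ** F (A + mat 1) B t)" by simp
  also have "\<dots> = (LBINT t:{0<..<1}. (B - mat 1) ** F A (B - mat 1) t) - (LBINT t:{0<..<1}. A ** F (A + mat 1) B t)"
    by (intro set_integral_diff matrix_mult_set_integral int)
  finally show ?thesis
    unfolding E by (simp only: matrix_mult_set_integral(1) int)
qed

lemma real_powr_matrix_diff_one:
  assumes "t > 0"
  shows "real_powr_matrix t P = t *\<^sub>R real_powr_matrix t (P - mat 1 :: complex^'n^'n)"
  using real_powr_matrix_shift[OF assms, of "P - mat 1" 1] assms by simp

text \<open>The relation of 1F1 carries the scalar -1/(t(1-t)). The two powers absorb it, which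
  lowers P and Q by I and leaves the minus sign; convergence of the new integral rests on P - I and
  Q - I.\<close>

lemma extended_Beta_contiguous_A:
  fixes A B Y P Q :: "complex^'n^'n"
  assumes A: "positive_stable (A - mat 1)" and B: "positive_stable B" and Y: "positive_stable Y"
    and AB: "commutes A B" and AY: "commutes A Y" and BY: "commutes B Y"
    and P: "positive_stable (P - mat 1)" and Q: "positive_stable (Q - mat 1)"
  shows "B ** extended_Beta A B Y P Q - B ** extended_Beta (A - mat 1) B Y P Q
    = - (Y ** extended_Beta A (B + mat 1) Y (P - mat 1) (Q - mat 1))"
proof -
  define F where "F A' B' P' Q' t = matrix_1F1 A' B' ((- 1 / (t * (1 - t))) *\<^sub>R Y)
         ** real_powr_matrix t (P' - mat 1) ** real_powr_matrix (1 - t) (Q' - mat 1)" for A' B' P' Q' t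
  have E: "extended_Beta A' B' Y P' Q' = (LBINT t:{0<..<1}. F A' B' P' Q' t)" for A' B' P' Q'
    by (simp add: extended_Beta_def F_def)
  have pos: "positive_stable A" "positive_stable P" "positive_stable Q" "positive_stable (B + mat 1)"
    using positive_stable_add_mat[OF A, of 1] positive_stable_add_mat[OF P, of 1]
      positive_stable_add_mat[OF Q, of 1] positive_stable_add_mat[OF B, of 1] by simp_all
  have comm: "commutes A (B + mat 1)" "commutes (A - mat 1) B" "commutes (A - mat 1) Y"
    "commutes (B + mat 1) Y"
    using AB AY BY by (auto intro!: commutes_add commutes_add_left commutes_diff_left)
  have int: "set_integrable lborel {0<..<1} (F A B P Q)"
    "set_integrable lborel {0<..<1} (F (A - mat 1) B P Q)"
    "set_integrable lborel {0<..<1} (F A (B + mat 1) (P - mat 1) (Q - mat 1))"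
    unfolding F_def
    by (intro extended_Beta_integrable0 A B Y AB AY BY P Q pos comm)+
  have pt: "B ** F A B P Q t - B ** F (A - mat 1) B P Q t = (- Y) ** F A (B + mat 1) (P - mat 1) (Q - mat 1) t"
    if t: "t \<in> {0<..<1}" for t
  proof -
    define x where "x = - 1 / (t * (1 - t))"
    define p q where "p = real_powr_matrix t (P - mat 1 - mat 1)"
      and "q = real_powr_matrix (1 - t) (Q - mat 1 - mat 1)"
    have p: "real_powr_matrix t (P - mat 1) = t *\<^sub>R p"
      unfolding p_def using t by (intro real_powr_matrix_diff_one) simp
    have q: "real_powr_matrix (1 - t) (Q - mat 1) = (1 - t) *\<^sub>R q"
      unfolding q_def using t by (intro real_powr_matrix_diff_one) simp
    have "B ** F A B P Q t - B ** F (A - mat 1) B P Q t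
        = (B ** matrix_1F1 A B (x *\<^sub>R Y) - B ** matrix_1F1 (A - mat 1) B (x *\<^sub>R Y)) ** (t *\<^sub>R p) ** ((1 - t) *\<^sub>R q)"
      unfolding F_def x_def[symmetric] p q by (simp only: matrix_mul_assoc mm.diff_left)
    also have "\<dots> = (x * t * (1 - t)) *\<^sub>R (Y ** matrix_1F1 A (B + mat 1) (x *\<^sub>R Y) ** p ** q)"
      unfolding matrix_1F1_contiguous_A[OF B AB AY BY]
      by (simp add: mm.scaleR_left mm.scaleR_right mult_ac)
    also have "x * t * (1 - t) = - 1" using t by (simp add: x_def)
    finally show ?thesis
      unfolding F_def x_def[symmetric] p_def q_def by (simp add: mm.minus_left matrix_mul_assoc)
  qed
  have "B ** extended_Beta A B Y P Q - B ** extended_Beta (A - mat 1) B Y P Q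
    = (LBINT t:{0<..<1}. B ** F A B P Q t) - (LBINT t:{0<..<1}. B ** F (A - mat 1) B P Q t)"
    unfolding E by (simp only: matrix_mult_set_integral(1) int)
  also have "\<dots> = (LBINT t:{0<..<1}. B ** F A B P Q t - B ** F (A - mat 1) B P Q t)"
    by (intro set_integral_diff(2)[symmetric] matrix_mult_set_integral int)
  also have "\<dots> = (LBINT t:{0<..<1}. (- Y) ** F A (B + mat 1) (P - mat 1) (Q - mat 1) t)"
    by (intro set_lebesgue_integral_cong) (use pt in auto)
  also have "\<dots> = (- Y) ** (LBINT t:{0<..<1}. F A (B + mat 1) (P - mat 1) (Q - mat 1) t)"
    by (rule matrix_mult_set_integral(1)[OF int(3), symmetric])
  finally show ?thesis unfolding E by (simp only: mm.minus_left)
qed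

section \<open>From the beta integrals to the double series\<close>

theorem theorem5p7:
  fixes A A1 B B1 B2 C1 Y :: "complex^'r^'r" and z w :: complex
  assumes "positive_stable A" "positive_stable A1" "positive_stable B"
    and "positive_stable B1" "positive_stable B2" "positive_stable C1"
    and "positive_stable (C1 - A1)" "positive_stable Y"
    and "\<forall>U\<in>{A, A1, B, C1, Y}. \<forall>V\<in>{A, A1, B, C1, Y}. U ** V = V ** U"
    and "norm z < 1" "norm w < 1"
  shows
    "(positive_stable (B - mat 1) \<longrightarrow>
        (B - (A + mat 1)) ** extended_Appell_F1 A B A1 B1 B2 C1 z w Y
        = (B - mat 1) ** extended_Appell_F1 A (B - mat 1) A1 B1 B2 C1 z w Y
          - A ** extended_Appell_F1 (A + mat 1) B A1 B1 B2 C1 z w Y)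
     \<and>
     (positive_stable (A - mat 1) \<and> positive_stable (A1 - mat 1)
        \<and> positive_stable (C1 - A1 - mat 1) \<longrightarrow>
        B ** extended_Appell_F1 A B A1 B1 B2 C1 z w Y
        - B ** extended_Appell_F1 (A - mat 1) B A1 B1 B2 C1 z w Y
        + Y ** matrix_inv (matrix_Beta A1 (C1 - A1))
            ** matrix_Beta (A1 - mat 1) (C1 - A1 - mat 1)
            ** extended_Appell_F1 A (B + mat 1) (A1 - mat 1) B1 B2 (C1 - mat 2) z w Y
        = 0)"
proof (intro conjI impI)
  note A = assms(1) and A1 = assms(2) and B = assms(3) and Q = assms(7) and Y = assms(8)
    and zw = assms(10,11)
  have comm: "commutes U V" if "U \<in> {A, A1, B, C1, Y}" "V \<in> {A, A1, B, C1, Y}" for U V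
    using assms(9) that unfolding commutes_def by blast
  have AB: "commutes A B" and AY: "commutes A Y" and BY: "commutes B Y" by (simp_all add: comm)
  \<comment> \<open>A multiplier on the left crosses only the scalar factor; the Pochhammer factors
    of B1 and B2 are never moved.\<close>
  have left: "X ** (mat c ** (E ** S ** b1 ** b2)) = mat c ** ((X ** E) ** S ** b1 ** b2)"
    for X E S b1 b2 :: "complex^'r^'r" and c
    by (simp add: matrix_mul_assoc mat_mult_commute[of c X])
  {
    assume B': "positive_stable (B - mat 1)"
    have A': "positive_stable (A + mat 1)" by (simp add: positive_stable_add_mat A)
    have comm': "commutes A (B - mat 1)" "commutes (A + mat 1) B" "commutes (A + mat 1) Y"
      "commutes (B - mat 1) Y"
      using AB AY BY by (auto intro!: commutes_diff commutes_add_left commutes_diff_left)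
    let ?T = "appell_term A B A1 B1 B2 C1 z w Y"
    let ?T1 = "appell_term A (B - mat 1) A1 B1 B2 C1 z w Y"
    let ?T2 = "appell_term (A + mat 1) B A1 B1 B2 C1 z w Y"
    have "(B - (A + mat 1)) ** ?T p = (B - mat 1) ** ?T1 p - A ** ?T2 p" for p
    proof -
      obtain m n where p: "p = (m, n)" by (cases p)
      have Pk: "positive_stable (A1 + mat (of_nat (m + n)))" by (simp add: positive_stable_add_mat A1)
      show ?thesis
        unfolding p appell_term_def prod.case left
          extended_Beta_contiguous_B[OF A B' Y AB AY BY Pk Q]
        by (simp only: mm.diff_left mm.diff_right)
    qed
    moreover have "((\<lambda>p. (B - (A + mat 1)) ** ?T p) has_sum
        (B - (A + mat 1)) ** extended_Appell_F1 A B A1 B1 B2 C1 z w Y) UNIV"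
      by (intro has_sum_bounded_linear[OF mm.bounded_linear_right] extended_Appell_F1_has_sum
          A B Y AB AY BY A1 Q zw)
    moreover have "((\<lambda>p. (B - mat 1) ** ?T1 p - A ** ?T2 p) has_sum
        ((B - mat 1) ** extended_Appell_F1 A (B - mat 1) A1 B1 B2 C1 z w Y
          - A ** extended_Appell_F1 (A + mat 1) B A1 B1 B2 C1 z w Y)) UNIV"
      by (intro has_sum_diff has_sum_bounded_linear[OF mm.bounded_linear_right]
          extended_Appell_F1_has_sum A A' B B' Y AB AY BY comm' A1 Q zw)
    ultimately show "(B - (A + mat 1)) ** extended_Appell_F1 A B A1 B1 B2 C1 z w Y
        = (B - mat 1) ** extended_Appell_F1 A (B - mat 1) A1 B1 B2 C1 z w Y
          - A ** extended_Appell_F1 (A + mat 1) B A1 B1 B2 C1 z w Y"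
      by (simp add: has_sum_unique)
  }
  {
    assume "positive_stable (A - mat 1) \<and> positive_stable (A1 - mat 1)
        \<and> positive_stable (C1 - A1 - mat 1)"
    then have A': "positive_stable (A - mat 1)" and A1': "positive_stable (A1 - mat 1)"
      and Q': "positive_stable (C1 - A1 - mat 1)" by auto
    \<comment> \<open>Lowering C1 by 2I and A1 by I lowers the second beta argument C1 - A1 by
      exactly I.\<close>
    have C: "C1 - mat 2 - (A1 - mat 1) = C1 - A1 - mat 1"
      by (simp add: vec_eq_iff mat_def)
    have B': "positive_stable (B + mat 1)" by (simp add: positive_stable_add_mat B)
    have comm': "commutes A (B + mat 1)" "commutes (A - mat 1) B" "commutes (A - mat 1) Y"
      "commutes (B + mat 1) Y"
      using AB AY BY by (auto intro!: commutes_add commutes_add_left commutes_diff_left)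
    have A1Q: "commutes A1 (C1 - A1)" and A1Q': "commutes (A1 - mat 1) (C1 - A1 - mat 1)"
    proof -
      show "commutes A1 (C1 - A1)" by (intro commutes_diff) (simp_all add: comm)
      show "commutes (A1 - mat 1) (C1 - A1 - mat 1)"
        by (intro commutes_diff commutes_diff_left commutes_mat commutes_mat_left) (simp_all add: comm)
    qed
    define b b' where "b = matrix_inv (matrix_Beta A1 (C1 - A1))"
      and "b' = matrix_Beta (A1 - mat 1) (C1 - A1 - mat 1)"
    define X where "X = Y ** b ** b'"
    have inv: "invertible (matrix_Beta A1 (C1 - A1))" "invertible b'"
      unfolding b'_def by (intro matrix_Beta_invertible A1 Q A1' Q' A1Q A1Q')+
    define T where "T A' B' A1' C1' = appell_term A' B' A1' B1 B2 C1' z w Y" for A' B' A1' C1'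
    have "B ** T A B A1 C1 p - B ** T (A - mat 1) B A1 C1 p
        + X ** T A (B + mat 1) (A1 - mat 1) (C1 - mat 2) p = 0" for p
    proof -
      obtain m n where p: "p = (m, n)" by (cases p)
      define P where "P = A1 + mat (of_nat (m + n))"
      have P': "A1 - mat 1 + mat (of_nat (m + n)) = P - mat 1" by (simp add: P_def)
      have "positive_stable (A1 - mat 1 + mat (of_nat (m + n)))"
        by (simp add: positive_stable_add_mat A1')
      then have Pk: "positive_stable (P - mat 1)" unfolding P' .
      define E where "E = extended_Beta A (B + mat 1) Y (P - mat 1) (C1 - A1 - mat 1)"
      \<comment> \<open>\<open>E\<close> is built from A, A1, B, C1 and Y alone, so it commutes with
        whatever commutes with these five, in particular with both beta matrices.\<close>
      have E_comm: "commutes U E" if "commutes U A" "commutes U A1" "commutes U B" "commutes U C1" "commutes U Y" for U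
        unfolding E_def P_def using that
        by (intro commutes_extended_Beta B' comm' commutes_add commutes_diff commutes_mat)
      have EV: "commutes E V" if "V \<in> {A, A1, B, C1, Y}" for V
        by (rule commutes_sym, intro E_comm comm) (use that in simp_all)
      have Eb: "commutes E b"
        unfolding b_def
        by (intro commutes_inv inv commutes_Beta A1 Q A1Q commutes_diff EV) simp_all
      have Eb': "commutes E b'"
        unfolding b'_def
        by (intro commutes_Beta A1' Q' A1Q' commutes_diff commutes_mat EV) simp_all
      \<comment> \<open>The shifted function carries its own normalization, the inverse of b', to
        the right of E. Moving b' and then b across E cancels it and leaves the normalization b of
        the other two functions.\<close>
      have "X ** (E ** matrix_inv b') = Y ** (b ** (b' ** E) ** matrix_inv b')"
        by (simp add: X_def matrix_mul_assoc)
      also have "b' ** E = E ** b'" using Eb' by (simp add: commutes_def)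
      also have "Y ** (b ** (E ** b') ** matrix_inv b') = Y ** (b ** E ** (b' ** matrix_inv b'))"
        by (simp add: matrix_mul_assoc)
      also have "\<dots> = Y ** (E ** b)"
        using Eb by (simp add: matrix_mult_inv[OF inv(2)] commutes_def)
      finally have XE: "X ** E ** matrix_inv b' = Y ** E ** b" by (simp add: matrix_mul_assoc)
      define c r1 r2 where "c = z ^ m * w ^ n / (fact m * fact n)"
        and "r1 = matrix_pochhammer B1 m" and "r2 = matrix_pochhammer B2 n"
      define E1 E2 where "E1 = extended_Beta A B Y P (C1 - A1)"
        and "E2 = extended_Beta (A - mat 1) B Y P (C1 - A1)"
      have rel: "B ** E1 - B ** E2 = - (Y ** E)"
        unfolding E1_def E2_def E_def
        by (rule extended_Beta_contiguous_A[OF A' B Y AB AY BY Pk Q'])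
      have T1: "B ** T A B A1 C1 p = mat c ** (B ** E1 ** b ** r1 ** r2)"
        and T2: "B ** T (A - mat 1) B A1 C1 p = mat c ** (B ** E2 ** b ** r1 ** r2)"
        unfolding T_def p appell_term_def prod.case left
        by (simp_all only: E1_def E2_def b_def c_def r1_def r2_def P_def)
      have T3: "X ** T A (B + mat 1) (A1 - mat 1) (C1 - mat 2) p
          = mat c ** (X ** E ** matrix_inv b' ** r1 ** r2)"
        unfolding T_def p appell_term_def prod.case left C P'
        by (simp only: E_def b'_def c_def r1_def r2_def)
      \<comment> \<open>All three terms now end in the same factor \<open>b ** r1 ** r2\<close>, so
        the relation between the beta integrals makes the summand vanish.\<close>
      have "B ** T A B A1 C1 p - B ** T (A - mat 1) B A1 C1 p
        + X ** T A (B + mat 1) (A1 - mat 1) (C1 - mat 2) p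
        = mat c ** ((B ** E1 - B ** E2 + Y ** E) ** b ** r1 ** r2)"
        unfolding T1 T2 T3 XE by (simp only: mm.diff_left mm.diff_right mm.add_left mm.add_right)
      also have "\<dots> = 0" by (simp add: rel)
      finally show ?thesis .
    qed
    moreover have "((\<lambda>p. B ** T A B A1 C1 p - B ** T (A - mat 1) B A1 C1 p
        + X ** T A (B + mat 1) (A1 - mat 1) (C1 - mat 2) p) has_sum
      (B ** extended_Appell_F1 A B A1 B1 B2 C1 z w Y
        - B ** extended_Appell_F1 (A - mat 1) B A1 B1 B2 C1 z w Y
        + X ** extended_Appell_F1 A (B + mat 1) (A1 - mat 1) B1 B2 (C1 - mat 2) z w Y)) UNIV"
    proof -
      have "positive_stable (C1 - mat 2 - (A1 - mat 1))" unfolding C by (rule Q')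
      then show ?thesis
        unfolding T_def
        by (intro has_sum_add has_sum_diff has_sum_bounded_linear[OF mm.bounded_linear_right]
          extended_Appell_F1_has_sum A A' B B' Y AB AY BY comm' A1 A1' Q zw)
    qed
    ultimately have "((\<lambda>p::nat \<times> nat. 0) has_sum
      (B ** extended_Appell_F1 A B A1 B1 B2 C1 z w Y
        - B ** extended_Appell_F1 (A - mat 1) B A1 B1 B2 C1 z w Y
        + X ** extended_Appell_F1 A (B + mat 1) (A1 - mat 1) B1 B2 (C1 - mat 2) z w Y)) UNIV"
      by simp
    then show "B ** extended_Appell_F1 A B A1 B1 B2 C1 z w Y
        - B ** extended_Appell_F1 (A - mat 1) B A1 B1 B2 C1 z w Y
        + Y ** matrix_inv (matrix_Beta A1 (C1 - A1))
            ** matrix_Beta (A1 - mat 1) (C1 - A1 - mat 1)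
            ** extended_Appell_F1 A (B + mat 1) (A1 - mat 1) B1 B2 (C1 - mat 2) z w Y
        = 0"
      unfolding X_def b_def b'_def by (rule has_sum_unique) simp
  }
qed

end
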